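(* Let $1\le p<\infty$ and let $X=(X,d,\mu)$ be a metric measure space. Assume that $\operatorname{supp}\mu$ is complete, and that every bounded $u\in N^{1,p}(X)$ is quasicontinuous. Then every $p$-path open set $U\subset X$ such that $\operatorname{supp}\mu\setminus U$ is analytic (in $\operatorname{supp}\mu$) is quasiopen.
   Context: Setting: $1\le p<\infty$, and $X=(X,d,\mu)$ is a metric space with metric $d$ and a positive complete Borel measure $\mu$ such that $\mu(B)<\infty$ for all open balls $B\subset X$. The support $\operatorname{supp}\mu$ is the set of all $x\in X$ such that every open ball centered at $x$ has positive measure; it is known to be separable in this setting. $X$ itself is not assumed separable or complete. Curves: a curve is a continuous mapping from an interval. Only compact rectifiable curves are considered; they are nonconstant unless otherwise stated and parameterized by arc length $ds$, so $\gamma:[0,l_\gamma]\to X$ with $l_\gamma$ the length of $\gamma$. A property holds for $p$-almost every ($p$-a.e.) curve if it fails only for a curve family $\Gamma$ for which there is a nonnegative Borel function $\rho\in L^p(X)$ with $\int_\gamma\rho\,ds=\infty$ for every $\gamma\in\Gamma$. Upper gradients: a nonnegative Borel function $g$ on $X$ is an upper gradient of $f:X\to[-\infty,\infty]$ if $|f(\gamma(0))-f(\gamma(l_\gamma))|\le\int_\gamma g\,ds$ for all nonconstant compact rectifiable curves $\gamma:[0,l_\gamma]\to X$, where the left-hand side is $\infty$ whenever at least one of its terms is infinite. Newtonian space and capacity: for measurable $f:X\to[-\infty,\infty]$ (defined everywhere, not just up to a.e. equivalence), $\|f\|_{N^{1,p}(X)}=\bigl(\int_X|f|^p\,d\mu+\inf_g\int_X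 g^p\,d\mu\bigr)^{1/p}$, with infimum over all upper gradients $g$ of $f$, and $N^{1,p}(X)=\{f:\|f\|_{N^{1,p}(X)}<\infty\}$. For $E\subset X$, $C_p(E)=\inf_u\|u\|_{N^{1,p}(X)}^p$, the infimum being over all $u\in N^{1,p}(X)$ with $u\ge1$ on $E$. A function $u:X\to[-\infty,\infty]$ is quasicontinuous if for every $\varepsilon>0$ there is an open set $G\subset X$ with $C_p(G)<\varepsilon$ such that $u|_{X\setminus G}$ is finite and continuous. A set $U\subset X$ is quasiopen if for every $\varepsilon>0$ there is an open set $G\subset X$ with $C_p(G)<\varepsilon$ and $G\cup U$ open. A set $U\subset X$ is $p$-path open if for $p$-a.e. curve $\gamma:[0,l_\gamma]\to X$ the set $\gamma^{-1}(U)$ is relatively open in $[0,l_\gamma]$. A subset of a complete separable metric space is analytic (Suslin) if it is a continuous image of a complete separable metric space (the empty set is analytic).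
   Formalization: It is additionally assumed that μ(X∖supp μ)=0; this is automatic for separable X, but the claim can fail without it if measurable cardinals exist. The complete separable space in "analytic" has its points among the reals (with any metric), which loses nothing by cardinality. *)

theory Defs
  imports "HOL-Analysis.Analysis"
begin

text \<open>
  The space \<open>X\<close> is a type of class \<^class>\<open>metric_space\<close>. Its measure \<open>M\<close> may live on any
  complete \<open>\<sigma>\<close>-algebra containing the Borel sets; the completion of a Borel measure is the
  main example.
\<close>

definition metric_measure_space :: "'a::metric_space measure \<Rightarrow> bool" where
  "metric_measure_space M \<longleftrightarrow>
     space M = UNIV \<and> sets borel \<subseteq> sets M \<and> complete_measure M \<and>
     (\<forall>x r. emeasure M (ball x r) < \<infinity>)"

text \<open>
  The complement of the support is open and locally null. It is null if \<open>X\<close> is separable, but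
  for nonseparable \<open>X\<close> this can fail in the presence of measurable cardinals, so where it is needed
  that the measure is carried by its support this is assumed explicitly.
\<close>

definition measure_support :: "'a::metric_space measure \<Rightarrow> 'a set" where
  "measure_support M = {x. \<forall>r>0. emeasure M (ball x r) > 0}"

definition ennreal_powr :: "ennreal \<Rightarrow> real \<Rightarrow> ennreal" where
  "ennreal_powr x p = (if x = \<infinity> then \<infinity> else ennreal (enn2real x powr p))"

subsection \<open>Curves\<close>

definition curve_length :: "(real \<Rightarrow> 'a::metric_space) \<Rightarrow> real \<Rightarrow> real \<Rightarrow> ennreal" where
  "curve_length \<gamma> a b =
     (SUP (n, t) \<in> {(n::nat, t::nat \<Rightarrow> real). mono t \<and> range t \<subseteq> {a..b}}.
        \<Sum>i<n. ennreal (dist (\<gamma> (t i)) (\<gamma> (t (Suc i)))))"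

text \<open>
  A nonconstant compact rectifiable curve parameterized by arc length is a pair \<open>(l, \<gamma>)\<close>,
  where \<open>l\<close> is its length; only the values of \<open>\<gamma>\<close> on \<open>{0..l}\<close> matter.
\<close>

definition arc_length_curve :: "real \<Rightarrow> (real \<Rightarrow> 'a::metric_space) \<Rightarrow> bool" where
  "arc_length_curve l \<gamma> \<longleftrightarrow>
     0 < l \<and> continuous_on {0..l} \<gamma> \<and>
     (\<forall>s t. 0 \<le> s \<and> s \<le> t \<and> t \<le> l \<longrightarrow> curve_length \<gamma> s t = ennreal (t - s))"

definition line_integral :: "real \<Rightarrow> (real \<Rightarrow> 'a::metric_space) \<Rightarrow> ('a \<Rightarrow> ennreal) \<Rightarrow> ennreal" where
  "line_integral l \<gamma> g = (\<integral>\<^sup>+ t \<in> {0..l}. g (\<gamma> t) \<partial>lborel)"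

definition exceptional_family ::
    "real \<Rightarrow> 'a::metric_space measure \<Rightarrow> (real \<times> (real \<Rightarrow> 'a)) set \<Rightarrow> bool" where
  "exceptional_family p M \<Gamma> \<longleftrightarrow>
     (\<exists>\<rho> \<in> borel_measurable borel.
        (\<integral>\<^sup>+ x. ennreal_powr (\<rho> x) p \<partial>M) < \<infinity> \<and>
        (\<forall>(l, \<gamma>) \<in> \<Gamma>. line_integral l \<gamma> \<rho> = \<infinity>))"

definition p_ae_curve ::
    "real \<Rightarrow> 'a::metric_space measure \<Rightarrow> (real \<Rightarrow> (real \<Rightarrow> 'a) \<Rightarrow> bool) \<Rightarrow> bool" where
  "p_ae_curve p M P \<longleftrightarrow> exceptional_family p M {(l, \<gamma>). arc_length_curve l \<gamma> \<and> \<not> P l \<gamma>}"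

subsection \<open>Newtonian functions and capacity\<close>

definition upper_gradient :: "('a::metric_space \<Rightarrow> ennreal) \<Rightarrow> ('a \<Rightarrow> ereal) \<Rightarrow> bool" where
  "upper_gradient g f \<longleftrightarrow>
     g \<in> borel_measurable borel \<and>
     (\<forall>l \<gamma>. arc_length_curve l \<gamma> \<longrightarrow>
        (if \<bar>f (\<gamma> 0)\<bar> = \<infinity> \<or> \<bar>f (\<gamma> l)\<bar> = \<infinity> then \<infinity> else e2ennreal \<bar>f (\<gamma> 0) - f (\<gamma> l)\<bar>)
          \<le> line_integral l \<gamma> g)"

definition newtonian_norm :: "real \<Rightarrow> 'a::metric_space measure \<Rightarrow> ('a \<Rightarrow> ereal) \<Rightarrow> ennreal" where
  "newtonian_norm p M f =
     ennreal_powr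
       ((\<integral>\<^sup>+ x. ennreal_powr (e2ennreal \<bar>f x\<bar>) p \<partial>M) +
        (INF g \<in> {g. upper_gradient g f}. \<integral>\<^sup>+ x. ennreal_powr (g x) p \<partial>M))
       (1 / p)"

definition newtonian_space :: "real \<Rightarrow> 'a::metric_space measure \<Rightarrow> ('a \<Rightarrow> ereal) set" where
  "newtonian_space p M = {f \<in> borel_measurable M. newtonian_norm p M f < \<infinity>}"

definition sobolev_capacity :: "real \<Rightarrow> 'a::metric_space measure \<Rightarrow> 'a set \<Rightarrow> ennreal" where
  "sobolev_capacity p M E =
     (INF u \<in> {u \<in> newtonian_space p M. \<forall>x\<in>E. 1 \<le> u x}. ennreal_powr (newtonian_norm p M u) p)"

definition quasicontinuous :: "real \<Rightarrow> 'a::metric_space measure \<Rightarrow> ('a \<Rightarrow> ereal) \<Rightarrow> bool" where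
  "quasicontinuous p M u \<longleftrightarrow>
     (\<forall>\<epsilon>>0. \<exists>G. open G \<and> sobolev_capacity p M G < ennreal \<epsilon> \<and>
        (\<forall>x \<in> - G. \<bar>u x\<bar> \<noteq> \<infinity>) \<and> continuous_on (- G) u)"

definition quasiopen :: "real \<Rightarrow> 'a::metric_space measure \<Rightarrow> 'a set \<Rightarrow> bool" where
  "quasiopen p M U \<longleftrightarrow>
     (\<forall>\<epsilon>>0. \<exists>G. open G \<and> sobolev_capacity p M G < ennreal \<epsilon> \<and> open (G \<union> U))"

definition p_path_open :: "real \<Rightarrow> 'a::metric_space measure \<Rightarrow> 'a set \<Rightarrow> bool" where
  "p_path_open p M U \<longleftrightarrow>
     p_ae_curve p M (\<lambda>l \<gamma>. openin (top_of_set {0..l}) {t \<in> {0..l}. \<gamma> t \<in> U})"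

subsection \<open>Analytic sets\<close>

text \<open>
  \<open>A\<close> is a continuous image of a complete separable metric space \<open>(Y, d)\<close>. Such a space has at
  most the cardinality of the continuum, so, transporting the metric along an injection, its
  underlying set can be taken inside the type \<^typ>\<open>real\<close> without loss of generality. The metric \<open>d\<close>
  is arbitrary and unrelated to the usual metric of the reals; \<open>Y\<close> may be empty.
\<close>

definition analytic_in :: "'a::metric_space set \<Rightarrow> 'a set \<Rightarrow> bool" where
  "analytic_in S A \<longleftrightarrow>
     (\<exists>(Y::real set) d f.
        Metric_space Y d \<and> Metric_space.mcomplete Y d \<and>
        separable_space (Metric_space.mtopology Y d) \<and>
        continuous_map (Metric_space.mtopology Y d) (top_of_set S) f \<and>
        f ` Y = A)"

end

theory Submission
  imports Defs
begin

text \<open>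
  Let \<open>\<rho>\<close> be a weight that makes the curves exceptional for the \<open>p\<close>-path openness of \<open>U\<close>, and fix
  an integrable step function \<open>0 < \<omega> \<le> 1\<close> that is locally bounded away from \<open>0\<close>. By the
  Vitali--Caratheodory theorem there is a lower semicontinuous \<open>g \<ge> max \<rho> \<omega>\<close> with \<open>g\<^sup>p\<close> integrable,
  and \<open>g\<close> may be set to \<open>\<infinity>\<close> off the support. Let \<open>u x\<close> be the infimum of
  \<open>\<omega> (\<gamma> l) * indicator U (\<gamma> l) + \<integral> g ds\<close> over all paths \<open>\<gamma>\<close> from \<open>x\<close>, constant ones included. Then
  \<open>0 \<le> u \<le> \<omega>\<close>, and \<open>g\<close> is an upper gradient of \<open>u\<close>.

  Clearly \<open>u = 0\<close> off \<open>U\<close>. If \<open>u x = 0\<close> for some \<open>x \<in> U\<close>, then concatenating back-and-forth loops from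
  \<open>x\<close> to points outside \<open>U\<close> of rapidly decreasing cost gives a curve along which \<open>\<rho>\<close> is
  integrable, but whose preimage of \<open>U\<close> is not open at \<open>0\<close>. Hence \<open>U = {u > 0}\<close>.

  Since \<open>g\<close> is lower semicontinuous, the set \<open>{u < a}\<close> within the support is a countable union of
  projections of closed conditions on paths, so it is a Suslin set and is measurable for the
  complete measure. Thus \<open>u\<close> is a bounded Newtonian function, hence quasicontinuous, and \<open>{u > 0}\<close>
  is quasiopen.
\<close>

subsection \<open>The Suslin operation\<close>

text \<open>The obstacle is measurability of \<open>u\<close>: the complement of \<open>U\<close> is
  only analytic within the support, so \<open>u\<close> need not be Borel, and the admissible paths
  must form a class closed under limits. This is why competitors are 1-Lipschitz maps of the real
  line rather than arc-length parametrized curves; arc length is restored only once, for the curve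
  made of loops in the positivity argument. Setting \<open>g\<close> to infinity off the support
  confines every path of finite cost that starts in the support to that set, where completeness
  supplies limits and separability supplies countably many labels. The terminal cost on
  \<open>U\<close> is \<open>\<omega>\<close> rather than 1 because \<open>X\<close> may have
  infinite measure while \<open>u\<close> has to be p-integrable. The bound
  \<open>\<omega> \<le> g\<close> makes cheap paths from a point short, so that they end where
  \<open>\<omega>\<close> is still bounded below.\<close>

definition suslin_op :: "(nat list \<Rightarrow> 'a set) \<Rightarrow> 'a set" where
  "suslin_op F = (\<Union>\<sigma>::nat \<Rightarrow> nat. \<Inter>n. F (map \<sigma> [0..<n]))"

text \<open>Dependent choice on the tree of finite sequences. It drives both Koenig's lemma and the
  successive choice of bounds in the inner approximation of Suslin sets.\<close>

lemma infinite_branch: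
  assumes "P []" and "\<And>s. P s \<Longrightarrow> \<exists>m::nat. P (s @ [m])"
  shows "\<exists>\<sigma>. \<forall>n. P (map \<sigma> [0..<n])"
proof -
  have "\<exists>f. \<forall>n. (P (f n) \<and> length (f n) = n) \<and> (\<exists>m. f (Suc n) = f n @ [m])"
  proof (rule dependent_nat_choice)
    show "\<exists>x. P x \<and> length x = 0"
      using assms(1) by auto
    show "\<exists>y. (P y \<and> length y = Suc n) \<and> (\<exists>m. y = x @ [m])" if "P x \<and> length x = n" for x n
      using assms(2)[of x] that by auto
  qed
  then obtain f \<sigma> where f: "\<And>n. P (f n)" "\<And>n. length (f n) = n" "\<And>n. f (Suc n) = f n @ [\<sigma> n]"
    by metis
  have "f n = map \<sigma> [0..<n]" for n
    by (induction n) (use f in auto)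
  then show ?thesis
    using f(1) by metis
qed

text \<open>Below the bounds \<open>b\<close> the tree branches finitely. The invariant
  \<open>P s\<close> says that \<open>s\<close> has bounded extensions in \<open>T\<close> of every
  length; if each child lost it, the finitely many admissible children would all be dead at a common
  level \<open>K\<close>.\<close>

lemma koenig:
  fixes T :: "nat list set"
  assumes T: "\<And>k. \<exists>s\<in>T. length s = k \<and> (\<forall>i<k. s ! i \<le> b i)"
    and prefix: "\<And>s k. s \<in> T \<Longrightarrow> take k s \<in> T"
  shows "\<exists>\<sigma>. \<forall>n. map \<sigma> [0..<n] \<in> T"
proof -
  define P where "P s \<longleftrightarrow> (\<forall>k\<ge>length s. \<exists>t\<in>T. length t = k \<and> (\<forall>i<k. t ! i \<le> b i) \<and> take (length s) t = s)" for s
  have "\<exists>\<sigma>. \<forall>n. P (map \<sigma> [0..<n])"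
  proof (rule infinite_branch)
    show "P []"
      using T by (simp add: P_def)
    fix s assume s: "P s"
    show "\<exists>m. P (s @ [m])"
    proof (rule ccontr)
      assume "\<not> ?thesis"
      then have "\<forall>m. \<exists>k\<ge>length (s @ [m]). \<not> (\<exists>t\<in>T. length t = k \<and> (\<forall>i<k. t ! i \<le> b i) \<and> take (length (s @ [m])) t = s @ [m])"
        unfolding P_def by blast
      from choice[OF this] obtain k where k: "\<And>m. length (s @ [m]) \<le> k m"
        "\<And>m. \<not> (\<exists>t\<in>T. length t = k m \<and> (\<forall>i<k m. t ! i \<le> b i) \<and> take (length (s @ [m])) t = s @ [m])"
        by blast
      define K where "K = Max (k ` {..b (length s)})"
      have K: "k m \<le> K" if "m \<le> b (length s)" for m
        unfolding K_def using that by (intro Max_ge) auto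
      have lK: "length s < K"
        using k(1)[of 0] K[of 0] by simp
      with s obtain t where t: "t \<in> T" "length t = K" "\<forall>i<K. t ! i \<le> b i" "take (length s) t = s"
        unfolding P_def by (metis less_imp_le)
      define m where "m = t ! length s"
      have "m \<le> b (length s)"
        using t lK by (simp add: m_def)
      then have "k m \<le> K" by (rule K)
      have "take (length (s @ [m])) (take (k m) t) = s @ [m]"
        using k(1)[of m] t lK by (simp add: m_def take_Suc_conv_app_nth min_def)
      moreover have "take (k m) t \<in> T" "length (take (k m) t) = k m" "\<forall>i<k m. take (k m) t ! i \<le> b i"
        using t prefix \<open>k m \<le> K\<close> by auto
      ultimately show False
        using k(2)[of m] by blast
    qed
  qed
  then obtain \<sigma> where \<sigma>: "\<And>n. P (map \<sigma> [0..<n])"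
    by blast
  have "map \<sigma> [0..<n] \<in> T" for n
    using \<sigma>[of n] unfolding P_def by (metis order_refl length_map take_all)
  then show ?thesis by blast
qed

text \<open>Bounds \<open>b 0\<close>, \<open>b 1\<close>, ... are chosen one at a time so that the
  branches with \<open>\<sigma> i \<le> b i\<close> for \<open>i < n\<close> still carry outer
  measure above \<open>r\<close>. This is possible because outer measure is continuous along
  increasing sequences of arbitrary sets. For fixed \<open>b\<close> only finitely many
  \<open>F s\<close> matter at each level, so the limit set is measurable.\<close>

lemma suslin_op_inner_approx:
  fixes F :: "nat list \<Rightarrow> 'a set"
  assumes F: "\<And>s. F s \<in> sets M" "\<And>s k. F s \<subseteq> F (take k s)" and fin: "emeasure M (F []) < \<infinity>"
    and r: "r < outer_measure_of M (suslin_op F)"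
  shows "\<exists>D\<in>sets M. D \<subseteq> suslin_op F \<and> r \<le> emeasure M D"
proof -
  define A where "A b = {x. \<exists>\<sigma>. (\<forall>i<length b. \<sigma> i \<le> b ! i) \<and> (\<forall>n. x \<in> F (map \<sigma> [0..<n]))}" for b :: "nat list"
  have A_sub: "A b \<subseteq> space M" for b
    using F(1) sets.sets_into_space unfolding A_def by blast
  have "\<exists>b. \<forall>n. r < outer_measure_of M (A (map b [0..<n]))"
  proof (rule infinite_branch)
    have "A [] = suslin_op F"
      by (auto simp: A_def suslin_op_def)
    then show "r < outer_measure_of M (A [])"
      using r by simp
    fix b assume b: "r < outer_measure_of M (A b)"
    have split_last: "(\<forall>i<length (b @ [m]). \<sigma> i \<le> (b @ [m]) ! i) \<longleftrightarrow>
        (\<forall>i<length b. \<sigma> i \<le> b ! i) \<and> \<sigma> (length b) \<le> m" for \<sigma> m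
      by (auto simp: nth_append less_Suc_eq)
    have "A b = (\<Union>m. A (b @ [m]))"
      unfolding A_def split_last by blast
    moreover have "incseq (\<lambda>m. A (b @ [m]))"
      unfolding A_def split_last by (intro monoI) (blast intro: order_trans)
    ultimately have "(SUP m. outer_measure_of M (A (b @ [m]))) = outer_measure_of M (A b)"
      using SUP_outer_measure_of_incseq[of "\<lambda>m. A (b @ [m])" M] A_sub by simp
    with b have "r < (SUP m. outer_measure_of M (A (b @ [m])))"
      by (simp only:)
    then show "\<exists>m. r < outer_measure_of M (A (b @ [m]))"
      unfolding less_SUP_iff by blast
  qed
  then obtain b where b: "\<And>n. r < outer_measure_of M (A (map b [0..<n]))"
    by blast
  define I where "I n = {s. length s = n \<and> (\<forall>i<n. s ! i \<le> b i)}" for n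
  define D where "D n = (\<Union>s\<in>I n. F s)" for n
  have fin_I: "finite (I n)" for n
  proof (rule finite_subset)
    have "s ! i \<in> {..Max (b ` {..<n})}" if "s \<in> I n" "i < n" for s i
      using that order_trans[OF _ Max_ge[of "b ` {..<n}" "b i"], of "s ! i"] unfolding I_def by simp
    then have "set s \<subseteq> {..Max (b ` {..<n})}" if "s \<in> I n" for s
      using that by (intro subsetI) (auto simp: in_set_conv_nth I_def)
    then show "I n \<subseteq> {s. set s \<subseteq> {..Max (b ` {..<n})} \<and> length s = n}"
      unfolding I_def by blast
    show "finite {s. set s \<subseteq> {..Max (b ` {..<n})} \<and> length s = n}"
      by (rule finite_lists_length_eq) simp
  qed
  have D[measurable]: "D n \<in> sets M" for n
    unfolding D_def using fin_I F(1) by (intro sets.finite_UN)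
  have dec: "decseq D"
  proof (rule decseq_SucI)
    fix n
    show "D (Suc n) \<subseteq> D n"
    proof
      fix x assume "x \<in> D (Suc n)"
      then obtain s where s: "s \<in> I (Suc n)" "x \<in> F s"
        by (auto simp: D_def)
      have "take n s \<in> I n"
        using s by (auto simp: I_def)
      moreover have "x \<in> F (take n s)"
        using s F(2) by blast
      ultimately show "x \<in> D n"
        by (auto simp: D_def)
    qed
  qed
  have "A (map b [0..<n]) \<subseteq> D n" for n
  proof
    fix x assume "x \<in> A (map b [0..<n])"
    then obtain \<sigma> where "\<forall>i<n. \<sigma> i \<le> b i" "\<forall>n. x \<in> F (map \<sigma> [0..<n])"
      by (auto simp: A_def)
    then show "x \<in> D n"
      unfolding D_def I_def by (intro UN_I[of "map \<sigma> [0..<n]"]) auto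
  qed
  then have le: "r \<le> emeasure M (D n)" for n
    using b[of n] outer_measure_of_mono[of "A (map b [0..<n])" "D n" M] by (auto simp: less_le_trans less_imp_le)
  have "(INF n. emeasure M (D n)) = emeasure M (\<Inter>n. D n)"
  proof (rule INF_emeasure_decseq)
    fix n
    have "D n \<subseteq> F []"
      using F(2)[of _ 0] by (auto simp: D_def)
    then have "emeasure M (D n) \<le> emeasure M (F [])"
      using F by (intro emeasure_mono)
    then show "emeasure M (D n) \<noteq> \<infinity>"
      using fin by (auto simp: top_unique)
  qed (use dec D in auto)
  moreover have "r \<le> (INF n. emeasure M (D n))"
    using le by (rule INF_greatest)
  \<comment> \<open>A point of every \<open>D n\<close> has a bounded \<open>s\<close> with
    \<open>x \<in> F s\<close> at each level, but these \<open>s\<close> need not extend one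
    another; Koenig's lemma supplies a single branch.\<close>
  moreover have "(\<Inter>n. D n) \<subseteq> suslin_op F"
  proof
    fix x assume x: "x \<in> (\<Inter>n. D n)"
    have "\<exists>\<sigma>. \<forall>n. map \<sigma> [0..<n] \<in> {s. x \<in> F s}"
    proof (rule koenig[where b = b])
      show "\<exists>s\<in>{s. x \<in> F s}. length s = k \<and> (\<forall>i<k. s ! i \<le> b i)" for k
        using x by (auto simp: D_def I_def)
    qed (use F(2) in blast)
    then show "x \<in> suslin_op F"
      by (auto simp: suslin_op_def)
  qed
  ultimately show ?thesis
    using D by (intro bexI[of _ "\<Inter>n. D n"]) auto
qed

text \<open>The Suslin set is squeezed between measurable subsets of almost full outer measure and a
  measurable hull of equal outer measure; completeness of \<open>M\<close> then makes it measurable.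
  Finite measure of \<open>B\<close> provides the continuity from above behind the inner
  approximation.\<close>

lemma suslin_op_fmeasurable:
  fixes F :: "nat list \<Rightarrow> 'a set"
  assumes "complete_measure M" and F: "\<And>s. F s \<in> sets M" and B: "B \<in> fmeasurable M" and FB: "\<And>s. F s \<subseteq> B"
  shows "suslin_op F \<in> fmeasurable M"
proof -
  interpret complete_measure M by fact
  \<comment> \<open>Intersecting over all prefixes makes the scheme decreasing along branches
    without changing its Suslin set.\<close>
  define F' where "F' s = (\<Inter>k\<le>length s. F (take k s))" for s
  have F'_map: "F' (map \<sigma> [0..<n]) = (\<Inter>k\<le>n. F (map \<sigma> [0..<k]))" for \<sigma> n
    by (simp add: F'_def take_map)
  have "suslin_op F' = suslin_op F"
    unfolding suslin_op_def F'_map by blast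
  moreover have F'_sets: "F' s \<in> sets M" for s
    unfolding F'_def using F by (intro sets.finite_INT) auto
  moreover have F'_dec: "F' s \<subseteq> F' (take k s)" for s k
    unfolding F'_def by (auto simp: min_def)
  moreover have F'B: "F' s \<subseteq> B" for s
    using FB unfolding F'_def by force
  ultimately have approx: "\<exists>D\<in>sets M. D \<subseteq> suslin_op F \<and> r \<le> emeasure M D"
    if "r < outer_measure_of M (suslin_op F)" for r
  proof -
    have "emeasure M (F' []) < \<infinity>"
      using B F'_sets F'B by (metis emeasure_mono fmeasurableD fmeasurableD2 infinity_ennreal_def order_le_less_trans top.not_eq_extremum)
    then show ?thesis
      using suslin_op_inner_approx[of F' M r] F'_sets F'_dec that \<open>suslin_op F' = suslin_op F\<close> by simp
  qed
  have sub: "suslin_op F \<subseteq> B"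
    using FB unfolding suslin_op_def by blast
  then have "suslin_op F \<subseteq> space M"
    using B sets.sets_into_space[of B M] by (auto dest!: fmeasurableD)
  from outer_measure_of_attain[OF this] obtain E
    where E: "E \<in> sets M" "suslin_op F \<subseteq> E" "outer_measure_of M (suslin_op F) = emeasure M E"
    by blast
  have EB: "emeasure M (E \<inter> B) = emeasure M E"
  proof (rule antisym)
    show "emeasure M (E \<inter> B) \<le> emeasure M E"
      using E B by (intro emeasure_mono) auto
    have "outer_measure_of M (suslin_op F) \<le> outer_measure_of M (E \<inter> B)"
      using E sub by (intro outer_measure_of_mono) auto
    then show "emeasure M E \<le> emeasure M (E \<inter> B)"
      using E B by (simp add: fmeasurableD)
  qed
  define H where "H = E \<inter> B"
  have H: "H \<in> fmeasurable M" "suslin_op F \<subseteq> H" "outer_measure_of M (suslin_op F) = emeasure M H"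
    using E B EB sub by (auto simp: H_def fmeasurable_Int_fmeasurable Int_commute)
  have "(suslin_op F \<in> fmeasurable M \<and> measure M H = measure M (suslin_op F))"
    unfolding fmeasurable_measure_inner_outer
  proof (intro conjI allI impI)
    fix e :: real assume e: "0 < e"
    show "\<exists>U\<in>fmeasurable M. suslin_op F \<subseteq> U \<and> measure M U < measure M H + e"
      using H e by (intro bexI[of _ H]) auto
    show "\<exists>T\<in>fmeasurable M. T \<subseteq> suslin_op F \<and> measure M H - e < measure M T"
    proof (cases "emeasure M H = 0")
      case True
      then show ?thesis
        using e by (intro bexI[of _ "{}"]) (auto simp: measure_def)
    next
      case False
      have eq: "emeasure M H = ennreal (measure M H)"
        using H by (simp add: emeasure_eq_measure2)
      with False have "0 < measure M H"
        by (auto simp: zero_less_measure_iff)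
      then have "ennreal (measure M H - e / 2) < outer_measure_of M (suslin_op F)"
        using e H eq by (simp add: ennreal_lessI)
      from approx[OF this] obtain D where D: "D \<in> sets M" "D \<subseteq> suslin_op F"
        "ennreal (measure M H - e / 2) \<le> emeasure M D"
        by blast
      have "D \<in> fmeasurable M"
        by (rule fmeasurableI2[OF H(1) order_trans[OF D(2) H(2)] D(1)])
      then have "emeasure M D = ennreal (measure M D)"
        by (rule emeasure_eq_measure2)
      with D have "ennreal (measure M H - e / 2) \<le> ennreal (measure M D)"
        by simp
      then have "measure M H - e / 2 \<le> measure M D"
        by (simp add: ennreal_le_iff)
      with D \<open>D \<in> fmeasurable M\<close> e show ?thesis
        by (intro bexI[of _ D]) auto
    qed
  qed
  then show ?thesis by simp
qed

text \<open>\<open>M\<close> is assumed finite only on balls, so the set is cut by balls of integer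
  radius about the arbitrary centre \<open>undefined\<close> and reassembled.\<close>

lemma suslin_op_closed_measurable:
  fixes F :: "nat list \<Rightarrow> 'a::metric_space set"
  assumes M: "metric_measure_space M" and F: "\<And>s. closed (F s)"
  shows "suslin_op F \<in> sets M"
proof -
  have M: "space M = UNIV" "sets borel \<subseteq> sets M" "complete_measure M" "\<And>x r. emeasure M (ball x r) < \<infinity>"
    using M by (auto simp: metric_measure_space_def)
  have "suslin_op F \<inter> ball undefined (real n) \<in> sets M" for n
  proof -
    have "suslin_op (\<lambda>s. F s \<inter> ball undefined (real n)) \<in> fmeasurable M"
    proof (rule suslin_op_fmeasurable[OF M(3)])
      show "ball undefined (real n) \<in> fmeasurable M"
        by (intro fmeasurableI subsetD[OF M(2)] M(4) borel_open open_ball)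
      show "F s \<inter> ball undefined (real n) \<in> sets M" for s
        by (intro subsetD[OF M(2)] sets.Int borel_closed borel_open F open_ball)
    qed auto
    moreover have "suslin_op (\<lambda>s. F s \<inter> ball undefined (real n)) = suslin_op F \<inter> ball undefined (real n)"
      unfolding suslin_op_def by blast
    ultimately show ?thesis
      by (simp add: fmeasurableD)
  qed
  then have "(\<Union>n. suslin_op F \<inter> ball undefined (real n)) \<in> sets M"
    by (intro sets.countable_UN) auto
  moreover have "(\<Union>n. suslin_op F \<inter> ball undefined (real n)) = suslin_op F"
    using reals_Archimedean2 by auto
  ultimately show ?thesis by simp
qed

text \<open>
  The labels play the role of countable covers of the space of witnesses: a sequence of witnesses
  whose labels stabilize should converge to a witness.
\<close>

lemma suslin_op_projection:
  fixes R :: "'a::metric_space \<Rightarrow> 'b \<Rightarrow> bool" and lab :: "nat \<Rightarrow> 'b \<Rightarrow> nat"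
  assumes "\<And>x X b \<sigma>. X \<longlonglongrightarrow> x \<Longrightarrow> (\<And>k. R (X k) (b k)) \<Longrightarrow> (\<And>i k. i < k \<Longrightarrow> lab i (b k) = \<sigma> i) \<Longrightarrow> \<exists>b. R x b"
  shows "\<exists>F. (\<forall>s. closed (F s)) \<and> {x. \<exists>b. R x b} = suslin_op F"
proof (intro exI conjI allI)
  \<comment> \<open>\<open>E s\<close> collects the points having a witness whose labels begin with
    \<open>s\<close>. A branch through the closures provides points tending to \<open>x\<close>
    whose witnesses agree on longer and longer initial labels, as the hypothesis requires.\<close>
  define E where "E s = {x. \<exists>b. R x b \<and> (\<forall>i<length s. lab i b = s ! i)}" for s
  show "closed (closure (E s))" for s
    by simp
  show "{x. \<exists>b. R x b} = suslin_op (\<lambda>s. closure (E s))"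
  proof (intro equalityI subsetI)
    fix x assume "x \<in> {x. \<exists>b. R x b}"
    then obtain b where "R x b" by blast
    then have "x \<in> E (map (\<lambda>i. lab i b) [0..<n])" for n
      by (auto simp: E_def)
    then have "x \<in> closure (E (map (\<lambda>i. lab i b) [0..<n]))" for n
      using closure_subset by blast
    then show "x \<in> suslin_op (\<lambda>s. closure (E s))"
      unfolding suslin_op_def by blast
  next
    fix x assume "x \<in> suslin_op (\<lambda>s. closure (E s))"
    then obtain \<sigma> where \<sigma>: "\<And>n. x \<in> closure (E (map \<sigma> [0..<n]))"
      unfolding suslin_op_def by blast
    have "\<exists>y b. dist y x < inverse (Suc n) \<and> R y b \<and> (\<forall>i<n. lab i b = \<sigma> i)" for n
    proof -
      have "\<exists>y\<in>E (map \<sigma> [0..<n]). dist y x < inverse (Suc n)"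
        using \<sigma>[of n] unfolding closure_approachable by (meson inverse_positive_iff_positive of_nat_0_less_iff zero_less_Suc)
      then show ?thesis
        unfolding E_def by auto
    qed
    then obtain X b where X: "\<And>n. dist (X n) x < inverse (Suc n)" "\<And>n. R (X n) (b n)"
      "\<And>i n. i < n \<Longrightarrow> lab i (b n) = \<sigma> i"
      by metis
    have "(\<lambda>n. dist (X n) x) \<longlonglongrightarrow> 0"
      by (rule tendsto_sandwich[OF _ _ tendsto_const LIMSEQ_inverse_real_of_nat])
        (use X(1) in \<open>auto intro!: always_eventually less_imp_le\<close>)
    then have "X \<longlonglongrightarrow> x"
      by (rule tendsto_dist_iff[THEN iffD2])
    from assms[OF this X(2,3)] show "x \<in> {x. \<exists>b. R x b}"
      by simp
  qed
qed

subsection \<open>Arc-length reparametrization\<close>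

text \<open>Cover \<open>B\<close> by nonoverlapping intervals inside an open set of nearly the same
  measure: \<open>s\<close> sends each into an interval of no greater length. Stating the bound for
  Borel \<open>E\<close> inside the image spares a proof that the image is Borel.\<close>

lemma emeasure_le_of_short_image:
  fixes s :: "real \<Rightarrow> real"
  assumes mono: "mono s" and short: "\<And>a b. \<bar>s a - s b\<bar> \<le> \<bar>a - b\<bar>"
    and B: "B \<in> sets borel" "B \<subseteq> {0..l}" and E: "E \<in> sets borel" "E \<subseteq> s ` B" and l: "0 < l"
  shows "emeasure lborel E \<le> emeasure lborel B"
proof (rule ennreal_le_epsilon)
  fix e :: real assume e: "0 < e"
  from outer_regular_lborel[OF B(1) e] obtain U where U: "open U" "B \<subseteq> U" "emeasure lborel (U - B) < e"
    by blast
  \<comment> \<open>Every interval from the covering lemma lies in \<open>g x\<close> for some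
    \<open>x \<in> B\<close>, and this gauge turns that into lying in \<open>U\<close>.\<close>
  define g where "g x = (if x \<in> U then U else UNIV)" for x
  have "gauge g"
    using U by (auto simp: g_def gauge_def)
  have "B \<subseteq> cbox 0 l" "box 0 l \<noteq> {}"
    using B(2) l by (auto simp: cbox_interval)
  then obtain \<D> where
    \<D>: "countable \<D>" "\<And>K. K \<in> \<D> \<Longrightarrow> interior K \<noteq> {} \<and> (\<exists>c d. K = cbox c d)"
      "pairwise (\<lambda>A B. interior A \<inter> interior B = {}) \<D>"
      "\<And>K. K \<in> \<D> \<Longrightarrow> \<exists>x\<in>B \<inter> K. K \<subseteq> g x" "B \<subseteq> \<Union>\<D>"
    by (rule covering_lemma[OF _ _ \<open>gauge g\<close>]) blast
  define h where "h K = {s (Inf K)..s (Sup K)}" for K :: "real set"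
  have K: "K \<subseteq> U \<and> s ` K \<subseteq> h K \<and> emeasure lborel (h K) \<le> emeasure lborel (interior K)" if "K \<in> \<D>" for K
  proof -
    from \<D>(2)[OF that] obtain c d where cd: "K = {c..d}" "c < d"
      by (force simp: cbox_interval)
    have "K \<subseteq> U"
      using \<D>(4)[OF that] U(2) unfolding g_def by fastforce
    moreover have h: "h K = {s c..s d}"
      using cd by (simp add: h_def)
    moreover have "s ` K \<subseteq> {s c..s d}"
      using cd mono by (auto simp: mono_def)
    moreover have "s d - s c \<le> d - c"
      using short[of d c] cd by linarith
    moreover have "s c \<le> s d"
      using cd mono by (auto simp: mono_def)
    ultimately show ?thesis
      using cd by (simp add: ennreal_le_iff)
  qed
  \<comment> \<open>Countable subadditivity is run as an integral over the counting measure on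
    \<open>\<D>\<close>, which avoids enumerating the cover.\<close>
  have "emeasure lborel E = (\<integral>\<^sup>+x. indicator E x \<partial>lborel)"
    using E by simp
  also have "\<dots> \<le> (\<integral>\<^sup>+x. (\<integral>\<^sup>+K. indicator (h K) x \<partial>count_space \<D>) \<partial>lborel)"
  proof (rule nn_integral_mono)
    fix x
    show "indicator E x \<le> (\<integral>\<^sup>+K. indicator (h K) x \<partial>count_space \<D>)"
    proof (cases "x \<in> E")
      case True
      then obtain t where "t \<in> B" "x = s t"
        using E by auto
      then obtain K where "K \<in> \<D>" "x \<in> h K"
        using \<D>(5) K by blast
      then have "indicator E x = (indicator (h K) x :: ennreal)"
        using True by simp
      also have "\<dots> \<le> (\<integral>\<^sup>+K. indicator (h K) x \<partial>count_space \<D>)"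
        by (rule nn_integral_ge_point) fact
      finally show ?thesis .
    qed simp
  qed
  also have "\<dots> = (\<integral>\<^sup>+K. (\<integral>\<^sup>+x. indicator (h K) x \<partial>lborel) \<partial>count_space \<D>)"
    by (rule nn_integral_count_space_nn_integral) (use \<D>(1) in \<open>auto simp: h_def\<close>)
  also have "\<dots> = (\<integral>\<^sup>+K. emeasure lborel (h K) \<partial>count_space \<D>)"
    by (simp add: h_def)
  also have "\<dots> \<le> (\<integral>\<^sup>+K. emeasure lborel (interior K) \<partial>count_space \<D>)"
    using K by (intro nn_integral_mono) auto
  also have "\<dots> = emeasure lborel (\<Union>K\<in>\<D>. interior K)"
    using \<D>(1,3) by (intro emeasure_UN_countable[symmetric]) (auto simp: disjoint_family_on_def pairwise_def)
  also have "\<dots> \<le> emeasure lborel U"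
  proof (rule emeasure_mono)
    show "(\<Union>K\<in>\<D>. interior K) \<subseteq> U"
      using K interior_subset by blast
  qed (use U in simp)
  also have "\<dots> = emeasure lborel B + emeasure lborel (U - B)"
  proof -
    have "U = B \<union> (U - B)"
      using U by blast
    then show ?thesis
      using U B plus_emeasure[of B lborel "U - B"] by simp
  qed
  also have "\<dots> \<le> emeasure lborel B + ennreal e"
    using U(3) by (intro add_left_mono) auto
  finally show "emeasure lborel E \<le> emeasure lborel B + ennreal e" .
qed

text \<open>By the preceding estimate, Lebesgue measure on \<open>{0..s l}\<close> is dominated by
  the image under \<open>s\<close> of Lebesgue measure on \<open>{0..l}\<close>. This yields the
  inequality without differentiating \<open>s\<close>; it shows that passing to arc length does not
  raise the cost of a curve.\<close>

lemma nn_integral_short_substitution: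
  fixes s :: "real \<Rightarrow> real"
  assumes mono: "mono s" and short: "\<And>a b. \<bar>s a - s b\<bar> \<le> \<bar>a - b\<bar>" and "s 0 = 0" "0 < l"
    and f: "f \<in> borel_measurable borel"
  shows "(\<integral>\<^sup>+r\<in>{0..s l}. f r \<partial>lborel) \<le> (\<integral>\<^sup>+t\<in>{0..l}. f (s t) \<partial>lborel)"
proof -
  have [measurable]: "s \<in> borel_measurable borel"
    by (rule borel_measurable_mono[OF mono])
  note f[measurable]
  let ?M = "density lborel (indicator {0..s l})" and ?N = "distr (density lborel (indicator {0..l})) borel s"
  have cont: "continuous_on {0..l} s"
    unfolding continuous_on_iff dist_real_def by (blast intro: le_less_trans short)
  have "?M \<le> ?N"
  proof -
    have "emeasure ?M E \<le> emeasure ?N E" if E[measurable]: "E \<in> sets borel" for E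
    proof -
      have "emeasure ?M E = emeasure lborel ({0..s l} \<inter> E)"
        by (simp add: emeasure_density nn_integral_indicator flip: indicator_inter_arith)
      also have "\<dots> \<le> emeasure lborel ({0..l} \<inter> s -` E)"
      proof (rule emeasure_le_of_short_image[OF mono short])
        show "{0..l} \<inter> s -` E \<in> sets borel"
          using measurable_sets[OF \<open>s \<in> borel_measurable borel\<close> E] by (intro sets.Int) auto
        show "{0..s l} \<inter> E \<subseteq> s ` ({0..l} \<inter> s -` E)"
        proof
          fix r assume r: "r \<in> {0..s l} \<inter> E"
          then obtain t where "0 \<le> t" "t \<le> l" "s t = r"
            using IVT'[of s 0 r l] assms cont by auto
          then show "r \<in> s ` ({0..l} \<inter> s -` E)"
            using r by auto
        qed
      qed (use \<open>0 < l\<close> in auto)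
      also have "\<dots> = emeasure ?N E"
        using measurable_sets[OF \<open>s \<in> borel_measurable borel\<close> E]
        by (simp add: emeasure_distr emeasure_density flip: indicator_inter_arith)
      finally show "emeasure ?M E \<le> emeasure ?N E" .
    qed
    then have "emeasure ?M E \<le> emeasure ?N E" for E
      by (cases "E \<in> sets borel") (simp_all add: emeasure_notin_sets)
    then show ?thesis
      by (simp add: le_measure_iff le_fun_def)
  qed
  then have "nn_integral ?M f \<le> nn_integral ?N f"
    by (intro nn_integral_mono_measure) auto
  then show ?thesis
    by (simp add: nn_integral_density nn_integral_distr mult.commute)
qed

text \<open>The total domain spares the bookkeeping of intervals, and the class contains constant
  paths and is closed under pointwise limits. Curves given on a compact interval enter it by being
  frozen beyond the endpoints.\<close>

definition short_path :: "(real \<Rightarrow> 'a::metric_space) \<Rightarrow> bool" where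
  "short_path \<gamma> \<longleftrightarrow> (\<forall>s t. dist (\<gamma> s) (\<gamma> t) \<le> \<bar>s - t\<bar>)"

lemma short_pathD: "short_path \<gamma> \<Longrightarrow> dist (\<gamma> s) (\<gamma> t) \<le> \<bar>s - t\<bar>"
  by (simp add: short_path_def)

lemma short_path_dist_le: "short_path \<gamma> \<Longrightarrow> s \<le> t \<Longrightarrow> dist (\<gamma> s) (\<gamma> t) \<le> t - s"
  using short_pathD[of \<gamma> s t] by simp

lemma short_path_continuous: "short_path \<gamma> \<Longrightarrow> continuous_on A \<gamma>"
  unfolding continuous_on_iff short_path_def dist_real_def by (meson le_less_trans)

lemma short_path_clamp:
  assumes "\<And>s t. \<lbrakk>a \<le> s; s \<le> t; t \<le> b\<rbrakk> \<Longrightarrow> dist (\<gamma> s) (\<gamma> t) \<le> t - s" "a \<le> b"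
  shows "short_path (\<lambda>t. \<gamma> (max a (min b t)))"
proof -
  have *: "dist (\<gamma> (max a (min b s))) (\<gamma> (max a (min b t))) \<le> t - s" if "s \<le> t" for s t
    using assms(1)[of "max a (min b s)" "max a (min b t)"] assms(2) that by (auto simp: max_def min_def split: if_splits)
  show ?thesis
    unfolding short_path_def
  proof (intro allI)
    fix s t
    show "dist (\<gamma> (max a (min b s))) (\<gamma> (max a (min b t))) \<le> \<bar>s - t\<bar>"
      using *[of s t] *[of t s] by (cases "s \<le> t") (auto simp: dist_commute)
  qed
qed

section \<open>The length functional\<close>

lemma curve_length_ge:
  "mono t \<Longrightarrow> range t \<subseteq> {a..b} \<Longrightarrow> (\<Sum>i<n. ennreal (dist (\<gamma> (t i)) (\<gamma> (t (Suc i))))) \<le> curve_length \<gamma> a b"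
  unfolding curve_length_def by (intro SUP_upper2[of "(n, t)"]) auto

lemma curve_length_le:
  assumes "\<And>n t. mono t \<Longrightarrow> range t \<subseteq> {a..b} \<Longrightarrow> (\<Sum>i<n. ennreal (dist (\<gamma> (t i)) (\<gamma> (t (Suc i))))) \<le> c"
  shows "curve_length \<gamma> a b \<le> c"
  unfolding curve_length_def using assms by (auto intro!: SUP_least simp del: sum_ennreal)

lemma dist_le_curve_length:
  assumes "a \<le> b"
  shows "ennreal (dist (\<gamma> a) (\<gamma> b)) \<le> curve_length \<gamma> a b"
proof -
  define t where "t i = (if i = 0 then a else b)" for i :: nat
  have "mono t" "range t \<subseteq> {a..b}"
    using assms by (auto simp: t_def mono_def)
  from curve_length_ge[OF this, of \<gamma> 1] show ?thesis
    by (simp add: t_def)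
qed

lemma curve_length_le_of_short:
  assumes short: "\<And>s t. \<lbrakk>a \<le> s; s \<le> t; t \<le> b\<rbrakk> \<Longrightarrow> dist (\<gamma> s) (\<gamma> t) \<le> t - s" and "a \<le> b"
  shows "curve_length \<gamma> a b \<le> ennreal (b - a)"
proof (rule curve_length_le)
  fix n :: nat and t :: "nat \<Rightarrow> real" assume t: "mono t" "range t \<subseteq> {a..b}"
  have "(\<Sum>i<n. ennreal (dist (\<gamma> (t i)) (\<gamma> (t (Suc i))))) = ennreal (\<Sum>i<n. dist (\<gamma> (t i)) (\<gamma> (t (Suc i))))"
    by (simp add: sum_ennreal)
  also have "\<dots> \<le> ennreal (\<Sum>i<n. t (Suc i) - t i)"
    using t by (intro ennreal_leI sum_mono short) (auto simp: mono_def image_subset_iff)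
  also have "(\<Sum>i<n. t (Suc i) - t i) = t n - t 0"
    by (rule sum_lessThan_telescope)
  also have "ennreal \<dots> \<le> ennreal (b - a)"
  proof -
    have "t n \<in> {a..b}" "t 0 \<in> {a..b}"
      using t(2) by blast+
    then show ?thesis
      by (intro ennreal_leI) simp
  qed
  finally show "(\<Sum>i<n. ennreal (dist (\<gamma> (t i)) (\<gamma> (t (Suc i))))) \<le> ennreal (b - a)" .
qed

text \<open>For \<open>\<le>\<close>, truncating a partition at \<open>b\<close> with
  \<open>min\<close> and \<open>max\<close> splits each of its steps; for the converse, partitions
  of the two halves are listed one after the other.\<close>

lemma curve_length_add:
  assumes "a \<le> b" "b \<le> c"
  shows "curve_length \<gamma> a c = curve_length \<gamma> a b + curve_length \<gamma> b c"
proof (rule antisym)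
  show "curve_length \<gamma> a c \<le> curve_length \<gamma> a b + curve_length \<gamma> b c"
  proof (rule curve_length_le)
    fix n :: nat and t :: "nat \<Rightarrow> real" assume t: "mono t" "range t \<subseteq> {a..c}"
    define t1 t2 where "t1 i = min (t i) b" and "t2 i = max (t i) b" for i
    have t1: "mono t1" "range t1 \<subseteq> {a..b}" and t2: "mono t2" "range t2 \<subseteq> {b..c}"
      using t assms by (auto simp: t1_def t2_def mono_def min_def max_def image_subset_iff intro: order_trans)
    have "ennreal (dist (\<gamma> (t i)) (\<gamma> (t (Suc i)))) \<le>
        ennreal (dist (\<gamma> (t1 i)) (\<gamma> (t1 (Suc i)))) + ennreal (dist (\<gamma> (t2 i)) (\<gamma> (t2 (Suc i))))" for i
    proof -
      have "t i \<le> t (Suc i)"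
        using t by (simp add: mono_def)
      then have "dist (\<gamma> (t i)) (\<gamma> (t (Suc i))) \<le>
          dist (\<gamma> (t1 i)) (\<gamma> (t1 (Suc i))) + dist (\<gamma> (t2 i)) (\<gamma> (t2 (Suc i)))"
        by (auto simp: t1_def t2_def min_def max_def intro: dist_triangle)
      then show ?thesis
        by (simp flip: ennreal_plus)
    qed
    then have "(\<Sum>i<n. ennreal (dist (\<gamma> (t i)) (\<gamma> (t (Suc i))))) \<le>
        (\<Sum>i<n. ennreal (dist (\<gamma> (t1 i)) (\<gamma> (t1 (Suc i))))) + (\<Sum>i<n. ennreal (dist (\<gamma> (t2 i)) (\<gamma> (t2 (Suc i)))))"
      unfolding sum.distrib[symmetric] by (rule sum_mono)
    also have "\<dots> \<le> curve_length \<gamma> a b + curve_length \<gamma> b c"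
      by (intro add_mono curve_length_ge t1 t2)
    finally show "(\<Sum>i<n. ennreal (dist (\<gamma> (t i)) (\<gamma> (t (Suc i))))) \<le> curve_length \<gamma> a b + curve_length \<gamma> b c" .
  qed
next
  have *: "(\<Sum>i<n. ennreal (dist (\<gamma> (t i)) (\<gamma> (t (Suc i))))) + (\<Sum>i<m. ennreal (dist (\<gamma> (u i)) (\<gamma> (u (Suc i)))))
      \<le> curve_length \<gamma> a c"
    if t: "mono t" "range t \<subseteq> {a..b}" and u: "mono u" "range u \<subseteq> {b..c}" for n m t u
  proof -
    \<comment> \<open>The \<open>n + 1\<close> points of \<open>t\<close> precede those of
      \<open>u\<close>. The extra step from \<open>t n\<close> to \<open>u 0\<close> only adds a
      nonnegative term, hence the \<open>Suc n + m\<close> summands.\<close>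
    define v where "v i = (if i \<le> n then t i else u (i - Suc n))" for i
    have tb: "t i \<le> b" "a \<le> t i" and ub: "b \<le> u i" "u i \<le> c" for i
      using t(2) u(2) by (auto simp: image_subset_iff)
    have "mono v"
    proof (rule monoI)
      fix i j :: nat assume "i \<le> j"
      then show "v i \<le> v j"
        using t(1) u(1) order_trans[OF tb(1) ub(1)] by (auto simp: v_def mono_def)
    qed
    moreover have "range v \<subseteq> {a..c}"
      using tb ub assms order_trans[OF tb(1) assms(2)] order_trans[OF assms(1) ub(1)] by (auto simp: v_def)
    ultimately have "(\<Sum>i<Suc n + m. ennreal (dist (\<gamma> (v i)) (\<gamma> (v (Suc i))))) \<le> curve_length \<gamma> a c"
      by (rule curve_length_ge)
    moreover have "(\<Sum>i<Suc n + m. ennreal (dist (\<gamma> (v i)) (\<gamma> (v (Suc i))))) =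
        (\<Sum>i<Suc n. ennreal (dist (\<gamma> (v i)) (\<gamma> (v (Suc i))))) +
        (\<Sum>i<m. ennreal (dist (\<gamma> (v (Suc n + i))) (\<gamma> (v (Suc (Suc n + i))))))"
      by (induction m) (simp_all add: add.assoc del: sum_ennreal)
    moreover have "(\<Sum>i<n. ennreal (dist (\<gamma> (t i)) (\<gamma> (t (Suc i))))) \<le> (\<Sum>i<Suc n. ennreal (dist (\<gamma> (v i)) (\<gamma> (v (Suc i)))))"
      by (simp add: v_def)
    moreover have "(\<Sum>i<m. ennreal (dist (\<gamma> (v (Suc n + i))) (\<gamma> (v (Suc (Suc n + i)))))) =
        (\<Sum>i<m. ennreal (dist (\<gamma> (u i)) (\<gamma> (u (Suc i)))))"
      by (simp add: v_def)
    ultimately show ?thesis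
      by (metis (no_types, lifting) add_right_mono order_trans)
  qed
  \<comment> \<open>Moving a sum through a supremum in \<open>ennreal\<close> requires a nonempty
    index set; a constant partition provides it.\<close>
  have part: "{(n::nat, t::nat \<Rightarrow> real). mono t \<and> range t \<subseteq> {u..w}} \<noteq> {}" if "u \<le> w" for u w
    using that by (auto intro!: exI[of _ "\<lambda>_. u"] simp: mono_def)
  have **: "(\<Sum>i<n. ennreal (dist (\<gamma> (t i)) (\<gamma> (t (Suc i))))) + curve_length \<gamma> b c \<le> curve_length \<gamma> a c"
    if t: "mono t" "range t \<subseteq> {a..b}" for n t
    unfolding curve_length_def[of \<gamma> b c]
    by (subst ennreal_SUP_add_right[OF part[OF assms(2)]], rule SUP_least)
      (use *[OF t] in \<open>auto simp del: sum_ennreal\<close>)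
  show "curve_length \<gamma> a b + curve_length \<gamma> b c \<le> curve_length \<gamma> a c"
    unfolding curve_length_def[of \<gamma> a b]
    by (subst ennreal_SUP_add_left[OF part[OF assms(1)], symmetric], rule SUP_least)
      (use ** in \<open>auto simp del: sum_ennreal\<close>)
qed

text \<open>\<open>s\<close> is the length of \<open>\<Gamma>\<close> up to a given time, and
  \<open>\<gamma>\<close> is \<open>\<Gamma>\<close> composed with a right inverse of
  \<open>s\<close>. Any right inverse will do, since \<open>\<Gamma>\<close> takes equal values
  where \<open>s\<close> does. Both maps are frozen outside their intervals to be Lipschitz on the
  whole line.\<close>

lemma arc_length_reparametrization:
  fixes \<Gamma> :: "real \<Rightarrow> 'a::metric_space"
  assumes short: "short_path \<Gamma>" and l: "0 < l" and nonconst: "\<exists>t\<in>{0..l}. \<Gamma> t \<noteq> \<Gamma> 0"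
  obtains \<gamma> s where "mono s" "\<And>a b. \<bar>s a - s b\<bar> \<le> \<bar>a - b\<bar>" "s 0 = 0" "arc_length_curve (s l) \<gamma>"
    "short_path \<gamma>" "\<And>t. t \<in> {0..l} \<Longrightarrow> \<gamma> (s t) = \<Gamma> t"
proof -
  define s0 where "s0 t = enn2real (curve_length \<Gamma> 0 t)" for t
  have len_le: "curve_length \<Gamma> a b \<le> ennreal (b - a)" if "a \<le> b" for a b
    using that by (intro curve_length_le_of_short short_path_dist_le[OF short])
  have s0: "curve_length \<Gamma> 0 t = ennreal (s0 t)" if "0 \<le> t" for t
    using len_le[OF that] unfolding s0_def by (subst ennreal_enn2real) (auto simp: less_top[symmetric] top_unique)
  have s0_nonneg: "0 \<le> s0 t" for t
    by (simp add: s0_def)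
  have len: "curve_length \<Gamma> a b = ennreal (s0 b - s0 a)" "s0 a \<le> s0 b" if "0 \<le> a" "a \<le> b" for a b
  proof -
    have fin: "curve_length \<Gamma> a b < top"
      using len_le[OF that(2)] by (auto simp: less_top[symmetric] top_unique)
    have "ennreal (s0 b) = ennreal (s0 a) + curve_length \<Gamma> a b"
      using curve_length_add[of 0 a b \<Gamma>] s0[of a] s0[of b] that by simp
    also have "curve_length \<Gamma> a b = ennreal (enn2real (curve_length \<Gamma> a b))"
      using fin by simp
    finally have *: "s0 b = s0 a + enn2real (curve_length \<Gamma> a b)"
      using s0_nonneg by (simp flip: ennreal_plus)
    then show "curve_length \<Gamma> a b = ennreal (s0 b - s0 a)"
      using fin by simp
    show "s0 a \<le> s0 b"
      using * by simp
  qed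
  have s0_le: "s0 b - s0 a \<le> b - a" if "0 \<le> a" "a \<le> b" for a b
    using len_le[of a b] len[OF that] that by (simp add: ennreal_le_iff)
  have dist_le: "dist (\<Gamma> a) (\<Gamma> b) \<le> s0 b - s0 a" if "0 \<le> a" "a \<le> b" for a b
    using dist_le_curve_length[OF that(2), of \<Gamma>] len[OF that] by (simp add: ennreal_le_iff)
  define c where "c t = max 0 (min l t)" for t
  define s where "s t = s0 (c t)" for t
  have c: "0 \<le> c t" "c t \<le> l" "t \<le> u \<Longrightarrow> c t \<le> c u" "\<bar>c t - c u\<bar> \<le> \<bar>t - u\<bar>" for t u
    using l by (auto simp: c_def)
  have c_id: "c t = t" if "t \<in> {0..l}" for t
    using that by (auto simp: c_def)
  have "mono s"
    by (rule monoI) (simp add: s_def len c)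
  have s_short: "\<bar>s a - s b\<bar> \<le> \<bar>a - b\<bar>" for a b
    using s0_le[of "c a" "c b"] s0_le[of "c b" "c a"] len(2)[of "c a" "c b"] len(2)[of "c b" "c a"] c(1)[of a] c(1)[of b] c(4)[of a b]
    unfolding s_def by linarith
  have "s 0 = 0"
    using len_le[of 0 0] l by (simp add: s_def c_def s0_def)
  have sl: "s l = s0 l"
    using l by (simp add: s_def c_def)
  have cont: "continuous_on {0..l} s"
    unfolding continuous_on_iff dist_real_def by (blast intro: le_less_trans s_short)
  define \<tau> where "\<tau> r = (SOME t. t \<in> {0..l} \<and> s t = r)" for r
  have \<tau>: "\<tau> r \<in> {0..l} \<and> s (\<tau> r) = r" if "r \<in> {0..s l}" for r
    unfolding \<tau>_def
  proof (rule someI_ex)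
    show "\<exists>t. t \<in> {0..l} \<and> s t = r"
      using IVT'[of s 0 r l] that \<open>s 0 = 0\<close> l cont by auto
  qed
  define \<gamma> where "\<gamma> r = \<Gamma> (\<tau> (max 0 (min (s l) r)))" for r
  have s_s0: "s t = s0 t" if "t \<in> {0..l}" for t
    using that by (simp add: s_def c_id)
  have dist_s: "dist (\<Gamma> a) (\<Gamma> b) \<le> \<bar>s a - s b\<bar>" if "a \<in> {0..l}" "b \<in> {0..l}" for a b
  proof (cases "a \<le> b")
    case True
    then show ?thesis
      using dist_le[of a b] s_s0 that by auto
  next
    case False
    then show ?thesis
      using dist_le[of b a] s_s0 that by (auto simp: dist_commute)
  qed
  have \<gamma>_s: "\<gamma> (s t) = \<Gamma> t" if t: "t \<in> {0..l}" for t
  proof -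
    have st: "s t \<in> {0..s l}"
      using monoD[OF \<open>mono s\<close>, of 0 t] monoD[OF \<open>mono s\<close>, of t l] \<open>s 0 = 0\<close> t by auto
    with \<tau>[OF st] dist_s[of "\<tau> (s t)" t] t have "\<Gamma> (\<tau> (s t)) = \<Gamma> t"
      by simp
    moreover have "max 0 (min (s l) (s t)) = s t"
      using st by simp
    ultimately show ?thesis
      by (simp add: \<gamma>_def)
  qed
  have "short_path (\<lambda>r. (\<Gamma> \<circ> \<tau>) (max 0 (min (s l) r)))"
  proof (rule short_path_clamp)
    fix r q assume rq: "0 \<le> r" "r \<le> q" "q \<le> s l"
    then have "\<tau> r \<in> {0..l}" "s (\<tau> r) = r" "\<tau> q \<in> {0..l}" "s (\<tau> q) = q"
      using \<tau>[of r] \<tau>[of q] by auto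
    then show "dist ((\<Gamma> \<circ> \<tau>) r) ((\<Gamma> \<circ> \<tau>) q) \<le> q - r"
      using dist_s[of "\<tau> r" "\<tau> q"] rq by simp
  next
    show "0 \<le> s l"
      by (simp add: sl s0_nonneg)
  qed
  then have "short_path \<gamma>"
    by (simp add: \<gamma>_def[abs_def])
  have "0 < s l"
  proof -
    from nonconst obtain t where t: "t \<in> {0..l}" "\<Gamma> t \<noteq> \<Gamma> 0"
      by blast
    have "0 < dist (\<Gamma> 0) (\<Gamma> t)"
      using t by simp
    also have "\<dots> \<le> s0 t - s0 0"
      using t by (intro dist_le) auto
    also have "\<dots> \<le> s l"
      using t len(2)[of t l] s0_nonneg[of 0] by (simp add: sl)
    finally show ?thesis .
  qed
  have "curve_length \<gamma> r q = ennreal (q - r)" if rq: "0 \<le> r" "r \<le> q" "q \<le> s l" for r q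
  proof (rule antisym)
    show "curve_length \<gamma> r q \<le> ennreal (q - r)"
      using rq by (intro curve_length_le_of_short short_path_dist_le[OF \<open>short_path \<gamma>\<close>])
  next
    \<comment> \<open>Every partition of \<open>{a..b}\<close> for \<open>\<Gamma>\<close> is
      carried by \<open>s\<close> to one of \<open>{r..q}\<close> for \<open>\<gamma>\<close> with
      the same sum, which bounds the length of \<open>\<gamma>\<close> below. If
      \<open>b < a\<close>, then \<open>q = r\<close> and the claim is trivial.\<close>
    define a b where "a = \<tau> r" and "b = \<tau> q"
    have ab: "a \<in> {0..l}" "b \<in> {0..l}" "s a = r" "s b = q"
      using \<tau>[of r] \<tau>[of q] rq by (auto simp: a_def b_def)
    show "ennreal (q - r) \<le> curve_length \<gamma> r q"
    proof (cases "a \<le> b")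
      case True
      have "ennreal (q - r) = curve_length \<Gamma> a b"
        using len(1)[of a b] True ab s_s0 by auto
      also have "\<dots> \<le> curve_length \<gamma> r q"
      proof (rule curve_length_le)
        fix n :: nat and t :: "nat \<Rightarrow> real" assume t: "mono t" "range t \<subseteq> {a..b}"
        then have t_in: "t i \<in> {0..l}" for i
          using ab by (auto simp: image_subset_iff intro: order_trans)
        have "mono (s \<circ> t)"
          using t(1) \<open>mono s\<close> by (simp add: mono_def)
        moreover have "range (s \<circ> t) \<subseteq> {r..q}"
          using t(2) \<open>mono s\<close> ab by (force simp: mono_def image_subset_iff)
        ultimately have "(\<Sum>i<n. ennreal (dist (\<gamma> ((s \<circ> t) i)) (\<gamma> ((s \<circ> t) (Suc i))))) \<le> curve_length \<gamma> r q"
          by (rule curve_length_ge)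
        then show "(\<Sum>i<n. ennreal (dist (\<Gamma> (t i)) (\<Gamma> (t (Suc i))))) \<le> curve_length \<gamma> r q"
          by (simp add: \<gamma>_s[OF t_in] del: sum_ennreal)
      qed
      finally show ?thesis .
    next
      case False
      then have "q \<le> r"
        using monoD[OF \<open>mono s\<close>, of b a] ab by simp
      then show ?thesis
        using rq by simp
    qed
  qed
  with \<open>0 < s l\<close> short_path_continuous[OF \<open>short_path \<gamma>\<close>] have "arc_length_curve (s l) \<gamma>"
    by (simp add: arc_length_curve_def)
  show thesis
    by (rule that; fact)
qed

subsection \<open>Lower semicontinuous majorants\<close>

text \<open>Induction over the generation of the Borel sets. Bounding the gap \<open>G - F\<close>,
  rather than two separate errors, makes the complement step symmetric.\<close>

lemma borel_regular:
  fixes B :: "'a::metric_space set"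
  assumes M: "sets borel \<subseteq> sets M" "emeasure M (space M) < \<infinity>"
    and B: "B \<in> sets borel" and e: "0 < (e::real)"
  shows "\<exists>F G. closed F \<and> open G \<and> F \<subseteq> B \<and> B \<subseteq> G \<and> emeasure M (G - F) < ennreal e"
proof -
  have fin: "emeasure M A \<noteq> \<infinity>" for A
    using emeasure_space[of M A] M(2) by (auto simp: top_unique)
  have MI: "A \<in> sets M" if "A \<in> sets borel" for A
    using M(1) that by blast
  have small: "\<exists>n. emeasure M (D n) < ennreal e"
    if "decseq D" "\<And>n. D n \<in> sets borel" "emeasure M (\<Inter>n. D n) < ennreal e" for D :: "nat \<Rightarrow> 'a set" and e
  proof -
    have "(INF n. emeasure M (D n)) = emeasure M (\<Inter>n. D n)"
      using that fin MI by (intro INF_emeasure_decseq) auto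
    with that(3) have "(INF n. emeasure M (D n)) < ennreal e"
      by simp
    then show ?thesis
      unfolding INF_less_iff by blast
  qed
  have "B \<in> sigma_sets UNIV {S. open S}"
    using B by (simp add: borel_def)
  then show ?thesis
    using e
  proof (induction B arbitrary: e rule: sigma_sets.induct)
    case (Basic B)
    then have "open B" by simp
    show ?case
    \<comment> \<open>\<open>infdist\<close> to the empty set is 0 by convention, so approximating
      an open set by its points at distance at least \<open>1 / (n + 1)\<close> from the complement
      breaks down for the whole space.\<close>
    proof (cases "B = UNIV")
      case True
      then show ?thesis
        using Basic(2) by (intro exI[of _ UNIV]) simp
    next
      case False
      define D where "D n = B \<inter> {x. infdist x (- B) < inverse (Suc n)}" for n
      have op: "open {x. infdist x (- B) < r}" for r
        by (intro open_Collect_less continuous_intros)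
      have "\<exists>n. emeasure M (D n) < ennreal e"
      proof (rule small)
        show "decseq D"
        proof (rule decseq_SucI)
          fix n
          have "inverse (Suc (Suc n)) \<le> inverse (Suc n)"
            by (simp add: field_simps)
          then show "D (Suc n) \<subseteq> D n"
            unfolding D_def using less_le_trans by blast
        qed
        show "D n \<in> sets borel" for n
          unfolding D_def using op \<open>open B\<close> by (intro borel_open open_Int)
        have "(\<Inter>n. D n) = {}"
        proof (intro equals0I)
          fix x assume x: "x \<in> (\<Inter>n. D n)"
          then have "x \<notin> - B"
            by (auto simp: D_def)
          then have "0 < infdist x (- B)"
            using \<open>open B\<close> False by (intro infdist_pos_not_in_closed) auto
          from reals_Archimedean[OF this] obtain n where "inverse (real (Suc n)) < infdist x (- B)"
            by blast
          with x show False
            by (auto simp: D_def dest!: spec[of _ n])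
        qed
        then show "emeasure M (\<Inter>n. D n) < ennreal e"
          using Basic(2) by simp
      qed
      then obtain n where n: "emeasure M (D n) < ennreal e" ..
      have "B - (B - {x. infdist x (- B) < inverse (Suc n)}) = D n"
        by (auto simp: D_def)
      moreover have "closed (B - {x. infdist x (- B) < inverse (Suc n)})"
      proof -
        have "B - {x. infdist x (- B) < inverse (Suc n)} = - {x. infdist x (- B) < inverse (Suc n)}"
        proof -
          have "infdist x (- B) < inverse (Suc n)" if "x \<notin> B" for x
            using that by simp
          then show ?thesis
            by blast
        qed
        then show ?thesis
          using op by (simp add: closed_Compl)
      qed
      ultimately show ?thesis
        using \<open>open B\<close> n by (intro exI[of _ "B - {x. infdist x (- B) < inverse (Suc n)}"] exI[of _ B]) auto
    qed
  next
    case Empty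
    then show ?case
      by (intro exI[of _ "{}"]) simp
  next
    case (Compl B)
    from Compl.IH[OF Compl.prems] obtain F G where *: "closed F" "open G" "F \<subseteq> B" "B \<subseteq> G" "emeasure M (G - F) < ennreal e"
      by (elim exE conjE)
    show ?case
    proof (intro exI conjI)
      show "closed (- G)" "open (- F)"
        using *(1,2) by (simp_all add: closed_Compl open_Compl)
      show "- G \<subseteq> UNIV - B" "UNIV - B \<subseteq> - F"
        using *(3,4) by blast+
      have "- F - - G = G - F"
        by blast
      with *(5) show "emeasure M (- F - - G) < ennreal e"
        by simp
    qed
  next
    case (Union B)
    \<comment> \<open>The tolerances add up to \<open>e / 2\<close>. The slack is spent on replacing
      the union of all \<open>F i\<close>, which need not be closed, by a finite union.\<close>
    have "\<exists>F G. closed F \<and> open G \<and> F \<subseteq> B i \<and> B i \<subseteq> G \<and> emeasure M (G - F) < ennreal (e / 2 * (1/2) ^ Suc i)" for i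
      using Union by (intro Union.IH) auto
    then obtain F G where FG: "\<And>i. closed (F i)" "\<And>i. open (G i)" "\<And>i. F i \<subseteq> B i" "\<And>i. B i \<subseteq> G i"
      "\<And>i. emeasure M (G i - F i) < ennreal (e / 2 * (1/2) ^ Suc i)"
      by metis
    define D where "D n = (\<Union>i. G i) - (\<Union>i<n. F i)" for n :: nat
    have closed: "closed (\<Union>i<n. F i)" for n :: nat
      using FG(1) by (intro closed_UN) auto
    have op: "open (\<Union>i. G i)"
      using FG(2) by (intro open_UN) auto
    have "\<exists>n. emeasure M (D n) < ennreal e"
    proof (rule small)
      show "decseq D"
        unfolding D_def by (intro decseq_SucI) auto
      show "D n \<in> sets borel" for n
        unfolding D_def using closed op by (intro sets.Diff borel_open borel_closed)
      have "emeasure M (\<Inter>n. D n) \<le> emeasure M (\<Union>i. G i - F i)"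
      proof (rule emeasure_mono)
        show "(\<Inter>n. D n) \<subseteq> (\<Union>i. G i - F i)"
        proof
          fix x assume x: "x \<in> (\<Inter>n. D n)"
          then obtain i where "x \<in> G i"
            by (auto simp: D_def)
          moreover have "x \<notin> F i"
            using x by (auto simp: D_def)
          ultimately show "x \<in> (\<Union>i. G i - F i)"
            by blast
        qed
      qed (use FG(1,2) MI in auto)
      also have "\<dots> \<le> (\<Sum>i. emeasure M (G i - F i))"
        using FG(1,2) MI by (intro emeasure_subadditive_countably) auto
      also have "\<dots> \<le> (\<Sum>i. ennreal (e / 2 * (1/2) ^ Suc i))"
        using FG(5) by (intro suminf_le) (auto intro: less_imp_le)
      also have "\<dots> = ennreal (e / 2 * 1)"
        using \<open>0 < e\<close> by (intro suminf_ennreal_eq sums_mult power_half_series) auto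
      also have "\<dots> < ennreal e"
        using \<open>0 < e\<close> by (intro ennreal_lessI) auto
      finally show "emeasure M (\<Inter>n. D n) < ennreal e" .
    qed
    then obtain n where n: "emeasure M (D n) < ennreal e" ..
    show ?case
    proof (intro exI conjI)
      show "closed (\<Union>i<n. F i)" "open (\<Union>i. G i)"
        by (fact closed op)+
      show "(\<Union>i<n. F i) \<subseteq> (\<Union>i. B i)" "(\<Union>i. B i) \<subseteq> (\<Union>i. G i)"
        using FG(3,4) by blast+
      show "emeasure M ((\<Union>i. G i) - (\<Union>i<n. F i)) < ennreal e"
        using n by (simp add: D_def)
    qed
  qed
qed

definition lsc :: "('a::topological_space \<Rightarrow> ennreal) \<Rightarrow> bool" where
  "lsc f \<longleftrightarrow> (\<forall>a. open {x. a < f x})"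

lemma lsc_borel: "lsc f \<Longrightarrow> f \<in> borel_measurable borel"
  by (intro borel_measurableI_greater) (auto simp: lsc_def)

lemma lsc_le_liminf:
  assumes f: "lsc f" and X: "X \<longlonglongrightarrow> x"
  shows "f x \<le> liminf (\<lambda>n. f (X n))"
  unfolding le_Liminf_iff
proof (intro allI impI)
  fix a assume "a < f x"
  then show "\<forall>\<^sub>F n in sequentially. a < f (X n)"
    using topological_tendstoD[OF X, of "{x. a < f x}"] f by (simp add: lsc_def)
qed

text \<open>The sum counts the naturals below \<open>h\<close>, so it is \<open>h\<close> rounded
  up. With the companion bound \<open>h + 1\<close> it expresses an integral through the measures of
  superlevel sets, up to the total mass.\<close>

lemma le_suminf_indicator_nat:
  fixes h :: ennreal
  shows "h \<le> (\<Sum>k. if of_nat k < h then 1 else 0)"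
proof -
  let ?S = "\<lambda>n. \<Sum>k<n. if of_nat k < h then 1 else (0 :: ennreal)"
  have S: "min (of_nat n) h \<le> ?S n" for n
  proof (induction n)
    case (Suc n)
    show ?case
    proof (cases "of_nat n < h")
      case True
      with Suc have "of_nat n \<le> ?S n"
        by simp
      then have "of_nat (Suc n) \<le> ?S (Suc n)"
        using True by (simp add: add.commute add_mono)
      then show ?thesis
        by (simp add: min.coboundedI1)
    next
      case False
      with Suc show ?thesis
        by (simp add: min.coboundedI2)
    qed
  qed simp
  have "h = (SUP n. min (of_nat n) h)"
  proof (cases "h = top")
    case True
    then show ?thesis
      by (simp add: ennreal_SUP_of_nat_eq_top)
  next
    case False
    then obtain n where "h < of_nat n"
      using ennreal_Ex_less_of_nat by (auto simp: less_top)
    then have "h = min (of_nat n) h"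
      by simp
    then show ?thesis
      by (intro antisym SUP_upper2[of n] SUP_least) auto
  qed
  also have "\<dots> \<le> (SUP n. ?S n)"
    by (rule SUP_mono) (use S in auto)
  also have "\<dots> = (\<Sum>k. if of_nat k < h then 1 else 0)"
    by (rule suminf_eq_SUP[symmetric])
  finally show ?thesis .
qed

lemma suminf_indicator_nat_le:
  fixes h :: ennreal
  shows "(\<Sum>k. if of_nat k < h then 1 else 0) \<le> h + 1"
proof -
  let ?S = "\<lambda>n. \<Sum>k<n. if of_nat k < h then 1 else (0 :: ennreal)"
  have S: "?S n \<le> of_nat n \<and> ?S n \<le> h + 1" for n
  proof (induction n)
    case (Suc n)
    show ?case
    proof (cases "of_nat n < h")
      case True
      with Suc have "?S (Suc n) \<le> of_nat n + 1" "of_nat n + 1 \<le> h + 1"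
        by (auto intro: add_mono)
      then show ?thesis
        by (auto simp: add.commute intro: order_trans)
    next
      case False
      with Suc show ?thesis
        by (auto intro: order_trans)
    qed
  qed simp
  then show ?thesis
    unfolding suminf_eq_SUP by (intro SUP_least) simp
qed

text \<open>
  The Vitali--Caratheodory theorem without control of the integral: the sets \<open>f > k \<omega>\<close> are enlarged
  to open sets whose excess \<open>\<omega>\<close>-measures are summable.
\<close>

lemma lsc_majorant:
  fixes M :: "'a::metric_space measure" and \<omega> f :: "'a \<Rightarrow> ennreal"
  assumes M: "sets borel \<subseteq> sets M" "space M = UNIV"
    and \<omega>[measurable]: "\<omega> \<in> borel_measurable borel" and \<omega>_nhds: "\<And>x. \<forall>\<^sub>F y in nhds x. \<omega> x \<le> \<omega> y"
    and \<omega>_pos: "\<And>x. 0 < \<omega> x" "\<And>x. \<omega> x < \<infinity>" and \<omega>_int: "(\<integral>\<^sup>+x. \<omega> x \<partial>M) < \<infinity>"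
    and f[measurable]: "f \<in> borel_measurable borel" and f_int: "(\<integral>\<^sup>+x. f x \<partial>M) < \<infinity>"
  shows "\<exists>g. lsc g \<and> (\<forall>x. f x \<le> g x) \<and> (\<forall>x. \<omega> x \<le> g x) \<and> (\<integral>\<^sup>+x. g x \<partial>M) < \<infinity>"
proof -
  have MI: "u \<in> borel_measurable M" if "u \<in> borel_measurable borel" for u :: "'a \<Rightarrow> ennreal"
    using that M by (auto simp: measurable_def)
  note [measurable] = MI[OF \<omega>] MI[OF f]
  \<comment> \<open>Regularity is available for finite measures; weighting by
    \<open>\<omega>\<close> makes the total mass finite, and dividing \<open>f\<close> by
    \<open>\<omega>\<close> preserves its integral.\<close>
  define N where "N = density M \<omega>"
  have N: "sets borel \<subseteq> sets N" "space N = UNIV" "emeasure N (space N) < \<infinity>"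
    using M \<omega>_int sets.top[of M] by (auto simp: N_def emeasure_density simp del: sets.top)
  have NI: "u \<in> borel_measurable N" if "u \<in> borel_measurable borel" for u :: "'a \<Rightarrow> ennreal"
    using MI[OF that] by (simp add: N_def)
  define h where "h x = f x / \<omega> x" for x
  have h[measurable]: "h \<in> borel_measurable borel"
    unfolding h_def by measurable
  have \<omega>h: "\<omega> x * h x = f x" for x
  proof -
    have "\<omega> x \<noteq> 0" "\<omega> x \<noteq> top"
      using \<omega>_pos[of x] by auto
    then have "f x * \<omega> x / \<omega> x = f x"
      by (rule mult_divide_eq_ennreal)
    then show ?thesis
      unfolding h_def ennreal_times_divide by (simp add: mult.commute)
  qed
  have h_int: "(\<integral>\<^sup>+x. h x \<partial>N) = (\<integral>\<^sup>+x. f x \<partial>M)"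
    unfolding N_def using MI[OF h] by (subst nn_integral_density) (auto simp: \<omega>h)
  define E where "E k = {x. of_nat k < h x}" for k :: nat
  have E: "E k \<in> sets borel" for k
    unfolding E_def by measurable
  have "\<exists>F G. closed F \<and> open G \<and> F \<subseteq> E k \<and> E k \<subseteq> G \<and> emeasure N (G - F) < ennreal ((1/2) ^ Suc k)" for k
    by (rule borel_regular[OF N(1,3) E]) simp
  then obtain F G where FG: "\<And>k. closed (F k)" "\<And>k. open (G k)" "\<And>k. F k \<subseteq> E k" "\<And>k. E k \<subseteq> G k"
    "\<And>k. emeasure N (G k - F k) < ennreal ((1/2) ^ Suc k)"
    by metis
  have G: "G k \<in> sets N" "F k \<in> sets N" "E k \<in> sets N" for k
    using FG(1,2) E N(1) by auto
  \<comment> \<open>The summand 1 guarantees \<open>\<omega> \<le> g\<close> for the product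
    \<open>g\<close> of \<open>\<omega>\<close> and \<open>h'\<close>; it costs only the finite mass
    of \<open>N\<close>.\<close>
  define h' :: "'a \<Rightarrow> ennreal" where "h' x = 1 + (\<Sum>k. indicator (G k) x)" for x
  have G_meas: "emeasure N (G k) \<le> emeasure N (E k) + ennreal ((1/2) ^ Suc k)" for k
  proof -
    have "emeasure N (G k) \<le> emeasure N (E k \<union> (G k - F k))"
      by (intro emeasure_mono) (use G FG(3)[of k] FG(4)[of k] in auto)
    also have "\<dots> \<le> emeasure N (E k) + emeasure N (G k - F k)"
      using G by (intro emeasure_subadditive) auto
    also have "\<dots> \<le> emeasure N (E k) + ennreal ((1/2) ^ Suc k)"
      using FG(5)[of k] by (intro add_left_mono) simp
    finally show ?thesis .
  qed
  have ind_E: "indicator (E k) x = (if of_nat k < h x then 1 else (0::ennreal))" for k x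
    by (simp add: E_def)
  have h_le: "h x \<le> h' x" for x
  proof -
    have "h x \<le> (\<Sum>k. indicator (E k) x)"
      unfolding ind_E by (rule le_suminf_indicator_nat)
    also have "\<dots> \<le> (\<Sum>k. indicator (G k) x)"
      using FG(4) by (intro suminf_le) (auto simp: indicator_def)
    finally show ?thesis
      unfolding h'_def by (metis add_increasing zero_le)
  qed
  have "(\<integral>\<^sup>+x. (\<Sum>k. indicator (G k) x) \<partial>N) = (\<Sum>k. emeasure N (G k))"
    using G by (subst nn_integral_suminf) auto
  also have "\<dots> \<le> (\<Sum>k. emeasure N (E k) + ennreal ((1/2) ^ Suc k))"
    using G_meas by (intro suminf_le) auto
  also have "\<dots> = (\<Sum>k. emeasure N (E k)) + (\<Sum>k. ennreal ((1/2) ^ Suc k))"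
    by (intro suminf_add[symmetric]) auto
  also have "(\<Sum>k. ennreal ((1/2) ^ Suc k)) = ennreal 1"
    using power_half_series by (intro suminf_ennreal_eq) auto
  also have "(\<Sum>k. emeasure N (E k)) = (\<integral>\<^sup>+x. (\<Sum>k. indicator (E k) x) \<partial>N)"
    using G by (subst nn_integral_suminf) auto
  also have "\<dots> \<le> (\<integral>\<^sup>+x. h x + 1 \<partial>N)"
    unfolding ind_E by (intro nn_integral_mono suminf_indicator_nat_le)
  also have "\<dots> = (\<integral>\<^sup>+x. h x \<partial>N) + emeasure N (space N)"
    using NI[OF h] by (subst nn_integral_add) auto
  finally have "(\<integral>\<^sup>+x. (\<Sum>k. indicator (G k) x) \<partial>N) \<le> (\<integral>\<^sup>+x. h x \<partial>N) + emeasure N (space N) + ennreal 1"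
    by (simp add: add_right_mono)
  also have "\<dots> < \<infinity>"
    using N(3) f_int h_int by (simp add: ennreal_add_less_top)
  finally have G_int: "(\<integral>\<^sup>+x. (\<Sum>k. indicator (G k) x) \<partial>N) < \<infinity>" .
  have G_sum[measurable]: "(\<lambda>x. \<Sum>k. indicator (G k) x :: ennreal) \<in> borel_measurable borel"
    using FG(2) by (intro borel_measurable_suminf_order) auto
  have h'_borel[measurable]: "h' \<in> borel_measurable borel"
    unfolding h'_def by measurable
  have h'_int: "(\<integral>\<^sup>+x. h' x \<partial>N) < \<infinity>"
    unfolding h'_def using N(3) G_int NI[OF G_sum] by (subst nn_integral_add) (auto simp: ennreal_add_less_top)
  define g where "g x = \<omega> x * h' x" for x
  have "lsc g"
    unfolding lsc_def
  proof (intro allI, subst open_subopen, intro ballI)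
    fix a x assume "x \<in> {x. a < g x}"
    \<comment> \<open>A finite partial sum already exceeds \<open>a\<close> at \<open>x\<close>, so
      near \<open>x\<close> only finitely many of the open sets and the local bound on
      \<open>\<omega>\<close> have to be controlled.\<close>
    moreover have "g y = (SUP n. \<omega> y * (1 + (\<Sum>k<n. indicator (G k) y)))" for y
      unfolding g_def h'_def suminf_eq_SUP by (simp add: ennreal_SUP_add_right SUP_mult_left_ennreal)
    note g_eq = this
    ultimately obtain n where n: "a < \<omega> x * (1 + (\<Sum>k<n. indicator (G k) x))"
      by (auto simp: less_SUP_iff)
    have "\<forall>\<^sub>F y in nhds x. indicator (G k) x \<le> (indicator (G k) y :: ennreal)" for k
    proof (cases "x \<in> G k")
      case True
      then have "\<forall>\<^sub>F y in nhds x. y \<in> G k"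
        using FG(2) by (intro eventually_nhds_in_open)
      then show ?thesis
        by eventually_elim (simp add: indicator_def)
    qed simp
    then have "\<forall>\<^sub>F y in nhds x. \<forall>k\<in>{..<n}. indicator (G k) x \<le> (indicator (G k) y :: ennreal)"
      by (intro eventually_ball_finite) auto
    with \<omega>_nhds[of x] have "\<forall>\<^sub>F y in nhds x. a < g y"
    proof eventually_elim
      case (elim y)
      then have "\<omega> x * (1 + (\<Sum>k<n. indicator (G k) x)) \<le> \<omega> y * (1 + (\<Sum>k<n. indicator (G k) y))"
        by (intro mult_mono add_left_mono sum_mono) auto
      also have "\<dots> \<le> g y"
        unfolding g_eq by (rule SUP_upper) simp
      finally show ?case
        by (rule less_le_trans[OF n])
    qed
    then show "\<exists>T. open T \<and> x \<in> T \<and> T \<subseteq> {x. a < g x}"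
      unfolding eventually_nhds by blast
  qed
  moreover have "f x \<le> g x" for x
    using mult_left_mono[OF h_le[of x], of "\<omega> x"] by (simp add: g_def \<omega>h)
  moreover have "\<omega> x \<le> g x" for x
    using mult_left_mono[of 1 "h' x" "\<omega> x"] by (simp add: g_def h'_def)
  moreover have "(\<integral>\<^sup>+x. g x \<partial>M) < \<infinity>"
    using h'_int MI[OF h'_borel] unfolding N_def g_def by (subst (asm) nn_integral_density) auto
  ultimately show ?thesis
    by blast
qed

text \<open>\<open>\<omega>\<close> depends only on the integer part \<open>N x\<close> of the
  distance to a base point. Near \<open>x\<close> the value of \<open>N\<close> does not exceed
  \<open>N x\<close>, and \<open>c\<close> is decreasing, so \<open>\<omega>\<close> does not drop
  there. On a unit ball \<open>N\<close> grows by at most one, whence the local lower bound. The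
  factor \<open>1 / (1 + m n)\<close> absorbs the measure of the ball of radius \<open>n + 1\<close>
  and leaves a geometric series.\<close>

lemma ex_integrable_weight:
  fixes M :: "'a::metric_space measure"
  assumes "metric_measure_space M"
  obtains \<omega> :: "'a \<Rightarrow> ennreal" where "\<omega> \<in> borel_measurable borel" "\<And>x. 0 < \<omega> x" "\<And>x. \<omega> x \<le> 1"
    "\<And>x. \<forall>\<^sub>F y in nhds x. \<omega> x \<le> \<omega> y" "\<And>x. \<exists>c>0. \<forall>y\<in>ball x 1. ennreal c \<le> \<omega> y" "(\<integral>\<^sup>+x. \<omega> x \<partial>M) < \<infinity>"
proof -
  have M: "sets borel \<subseteq> sets M" "\<And>x r. emeasure M (ball x r) < \<infinity>"
    using assms by (auto simp: metric_measure_space_def)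
  define x0 :: 'a where "x0 = undefined"
  define m where "m n = measure M (ball x0 (real n + 1))" for n
  define c where "c n = (1/2) ^ n / (1 + m n)" for n
  define N where "N x = nat \<lfloor>dist x0 x\<rfloor>" for x
  have ball: "ball x0 r \<in> sets M" for r
    using M(1) by auto
  have em: "emeasure M (ball x0 (real n + 1)) = ennreal (m n)" for n
    unfolding m_def using M(2) by (intro emeasure_eq_ennreal_measure) (simp add: less_top)
  have m: "0 \<le> m n" for n
    by (simp add: m_def)
  have m_mono: "m n \<le> m k" if "n \<le> k" for n k
  proof -
    have "emeasure M (ball x0 (real n + 1)) \<le> emeasure M (ball x0 (real k + 1))"
      using that ball by (intro emeasure_mono) auto
    then show ?thesis
      using m by (simp add: em ennreal_le_iff)
  qed
  have c_pos: "0 < c n" for n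
    using m[of n] by (simp add: c_def)
  have c_anti: "c k \<le> c n" if "n \<le> k" for n k
    unfolding c_def using m[of n] m[of k] m_mono[OF that] that by (intro frac_le power_decreasing) auto
  have c_le: "c n \<le> 1" for n
    using m[of n] power_le_one[of "1/2 :: real" n] by (simp add: c_def divide_le_eq)
  have dist_N: "dist x0 x < real (N x) + 1" for x
    unfolding N_def by linarith
  have N_le: "N x \<le> n" if "dist x0 x < real n + 1" for x n
    unfolding N_def using that by (simp add: nat_le_iff floor_le_iff)
  show thesis
  proof (rule that[of "\<lambda>x. ennreal (c (N x))"])
    show "(\<lambda>x. ennreal (c (N x))) \<in> borel_measurable borel"
    proof -
      have [measurable]: "(\<lambda>x. dist x0 x) \<in> borel_measurable borel"
        by (intro borel_measurable_continuous_onI continuous_intros)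
      show ?thesis
        unfolding N_def by measurable
    qed
    show "0 < ennreal (c (N x))" "ennreal (c (N x)) \<le> 1" for x
      using c_pos c_le by auto
    show "\<forall>\<^sub>F y in nhds x. ennreal (c (N x)) \<le> ennreal (c (N y))" for x
    proof -
      have "\<forall>\<^sub>F y in nhds x. y \<in> ball x0 (real (N x) + 1)"
        using dist_N[of x] by (intro eventually_nhds_in_open) auto
      then show ?thesis
        by eventually_elim (auto intro!: ennreal_leI c_anti N_le)
    qed
    show "\<exists>d>0. \<forall>y\<in>ball x 1. ennreal d \<le> ennreal (c (N y))" for x
    proof (intro exI conjI ballI)
      show "0 < c (N x + 1)"
        by (rule c_pos)
      fix y assume "y \<in> ball x 1"
      then have "dist x0 y < real (N x + 1) + 1"
        using dist_N[of x] dist_triangle[of x0 y x] by simp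
      then show "ennreal (c (N x + 1)) \<le> ennreal (c (N y))"
        by (intro ennreal_leI c_anti N_le)
    qed
    have "(\<integral>\<^sup>+x. ennreal (c (N x)) \<partial>M) \<le> (\<integral>\<^sup>+x. (\<Sum>n. ennreal (c n) * indicator (ball x0 (real n + 1)) x) \<partial>M)"
    proof (rule nn_integral_mono)
      fix x
      have "ennreal (c (N x)) = (\<Sum>n\<in>{N x}. ennreal (c n) * indicator (ball x0 (real n + 1)) x)"
        using dist_N[of x] by simp
      also have "\<dots> \<le> (\<Sum>n. ennreal (c n) * indicator (ball x0 (real n + 1)) x)"
        by (intro sum_le_suminf) auto
      finally show "ennreal (c (N x)) \<le> (\<Sum>n. ennreal (c n) * indicator (ball x0 (real n + 1)) x)" .
    qed
    also have "\<dots> = (\<Sum>n. ennreal (c n) * emeasure M (ball x0 (real n + 1)))"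
      using ball by (subst nn_integral_suminf) (auto simp: nn_integral_cmult)
    also have "\<dots> \<le> (\<Sum>n. ennreal ((1/2) ^ n))"
    proof (rule suminf_le)
      fix n
      have "c n * m n \<le> (1/2) ^ n"
      proof -
        have "c n * m n = (1/2) ^ n * (m n / (1 + m n))"
          by (simp add: c_def)
        also have "\<dots> \<le> (1/2) ^ n * 1"
          using m[of n] by (intro mult_left_mono) (auto simp: divide_le_eq)
        finally show ?thesis
          by simp
      qed
      then show "ennreal (c n) * emeasure M (ball x0 (real n + 1)) \<le> ennreal ((1/2) ^ n)"
        using c_pos[of n] m[of n] by (simp add: em ennreal_leI flip: ennreal_mult)
    qed auto
    also have "\<dots> = ennreal 2"
      using geometric_sums[of "1/2 :: real"] by (intro suminf_ennreal_eq) auto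
    also have "\<dots> < \<infinity>"
      by simp
    finally show "(\<integral>\<^sup>+x. ennreal (c (N x)) \<partial>M) < \<infinity>" .
  qed
qed

subsection \<open>Separability of the support\<close>

text \<open>Within a set of finite measure only finitely many disjoint sets can have measure above
  \<open>1 / (k + 1)\<close>; let \<open>k\<close> vary.\<close>

lemma countable_disjoint_positive_measure:
  assumes disj: "disjoint_family_on X I" and X: "\<And>i. i \<in> I \<Longrightarrow> X i \<in> sets M" "\<And>i. i \<in> I \<Longrightarrow> X i \<subseteq> B"
    and B: "B \<in> fmeasurable M" and pos: "\<And>i. i \<in> I \<Longrightarrow> 0 < emeasure M (X i)"
  shows "countable I"
proof -
  have fm: "X i \<in> fmeasurable M" if "i \<in> I" for i
    using fmeasurableI2[OF B X(2,1)] that by blast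
  have posm: "0 < measure M (X i)" if "i \<in> I" for i
    using pos[OF that] emeasure_eq_measure2[OF fm[OF that]] by simp
  define J where "J k = {i\<in>I. 1 / real (Suc k) < measure M (X i)}" for k
  have "finite (J k)" for k
  proof -
    have "card G \<le> nat \<lceil>measure M B * real (Suc k)\<rceil>" if G: "G \<subseteq> J k" "finite G" for G
    proof -
      have GI: "G \<subseteq> I"
        using G(1) by (auto simp: J_def)
      have "real (card G) * (1 / real (Suc k)) \<le> (\<Sum>i\<in>G. measure M (X i))"
        using G(1) by (intro sum_bounded_below) (force simp: J_def)
      also have "\<dots> = measure M (\<Union>i\<in>G. X i)"
      proof (rule measure_finite_Union[symmetric])
        show "X ` G \<subseteq> sets M"
          using X(1) GI by blast
        show "disjoint_family_on X G"
          using disj GI by (rule disjoint_family_on_mono[rotated])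
        show "emeasure M (X i) \<noteq> \<infinity>" if "i \<in> G" for i
          using fmeasurableD2[OF fm] GI that by auto
      qed (rule G)
      also have "\<dots> \<le> measure M B"
        using X GI B G(2) by (intro measure_mono_fmeasurable sets.finite_UN) auto
      finally have "real (card G) \<le> measure M B * real (Suc k)"
        by (simp add: field_simps)
      then show ?thesis
        by linarith
    qed
    then show ?thesis
      using finite_if_finite_subsets_card_bdd by blast
  qed
  then have "countable (\<Union>k. J k)"
    by (simp add: countable_finite)
  moreover have "I \<subseteq> (\<Union>k. J k)"
  proof
    fix i assume i: "i \<in> I"
    from nat_approx_posE[OF posm[OF i]] obtain k where "1 / real (Suc k) < measure M (X i)"
      by blast
    with i show "i \<in> (\<Union>k. J k)"
      by (auto simp: J_def)
  qed
  ultimately show ?thesis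
    by (rule countable_subset[rotated])
qed

text \<open>Zorn's lemma: a maximal separated set is a net, because a point far from all of it could
  be added.\<close>

lemma ex_maximal_separated:
  fixes S :: "'a::metric_space set"
  assumes "0 < e"
  obtains D where "D \<subseteq> S" "\<And>x y. x \<in> D \<Longrightarrow> y \<in> D \<Longrightarrow> x \<noteq> y \<Longrightarrow> e \<le> dist x y"
    "\<And>x. x \<in> S \<Longrightarrow> \<exists>y\<in>D. dist x y < e"
proof -
  let ?A = "{D. D \<subseteq> S \<and> (\<forall>x\<in>D. \<forall>y\<in>D. x \<noteq> y \<longrightarrow> e \<le> dist x y)}"
  have "\<exists>D\<in>?A. \<forall>X\<in>?A. D \<subseteq> X \<longrightarrow> X = D"
  proof (rule subset_Zorn')
    fix C assume C: "subset.chain ?A C"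
    show "\<Union>C \<in> ?A"
    proof (intro CollectI conjI ballI impI)
      show "\<Union>C \<subseteq> S"
        using C unfolding subset_chain_def by blast
      fix x y assume "x \<in> \<Union>C" "y \<in> \<Union>C" and ne: "x \<noteq> y"
      then obtain X Y where XY: "X \<in> C" "Y \<in> C" "x \<in> X" "y \<in> Y"
        by blast
      have "X \<subseteq> Y \<or> Y \<subseteq> X"
        using C XY unfolding subset_chain_def by blast
      then obtain Z where Z: "Z \<in> C" "x \<in> Z" "y \<in> Z"
        using XY by blast
      then have "Z \<in> ?A"
        using C unfolding subset_chain_def by blast
      then show "e \<le> dist x y"
        using Z ne by blast
    qed
  qed
  then obtain D where D: "D \<in> ?A" "\<forall>X\<in>?A. D \<subseteq> X \<longrightarrow> X = D"
    by (rule bexE)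
  show thesis
  proof (rule that[of D])
    fix x assume x: "x \<in> S"
    show "\<exists>y\<in>D. dist x y < e"
    proof (rule ccontr)
      assume "\<not> ?thesis"
      then have far: "\<And>y. y \<in> D \<Longrightarrow> e \<le> dist x y"
        by (auto simp: not_less)
      have "insert x D \<in> ?A"
        using D(1) x far by (auto simp: dist_commute)
      with D(2) have "D \<subseteq> insert x D \<longrightarrow> insert x D = D"
        by (rule bspec)
      then have "insert x D = D"
        by blast
      then have "e \<le> dist x x"
        using far by blast
      then show False
        using assms by simp
    qed
  qed (use D(1) in auto)
qed

text \<open>Balls of radius \<open>e / 2\<close> about the points of an \<open>e\<close>-separated
  subset of the support are disjoint and have positive measure, so such a subset is countable in
  every bounded region. Maximal ones for \<open>e = 1 / (n + 1)\<close> together are dense.\<close>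

lemma measure_support_separable:
  fixes M :: "'a::metric_space measure"
  assumes "metric_measure_space M"
  obtains D where "countable D" "D \<subseteq> measure_support M" "\<And>x r. x \<in> measure_support M \<Longrightarrow> 0 < r \<Longrightarrow> \<exists>y\<in>D. dist x y < r"
proof -
  have M: "sets borel \<subseteq> sets M" "\<And>x r. emeasure M (ball x r) < \<infinity>"
    using assms by (auto simp: metric_measure_space_def)
  have ball: "ball x r \<in> sets M" for x r
    using M(1) by auto
  have "\<exists>D. countable D \<and> D \<subseteq> measure_support M \<and> (\<forall>x\<in>measure_support M. \<exists>y\<in>D. dist x y < e)"
    if e: "0 < e" for e
  proof -
    from ex_maximal_separated[OF e, of "measure_support M"]
    obtain D where D: "D \<subseteq> measure_support M" "\<And>x y. x \<in> D \<Longrightarrow> y \<in> D \<Longrightarrow> x \<noteq> y \<Longrightarrow> e \<le> dist x y"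
      "\<And>x. x \<in> measure_support M \<Longrightarrow> \<exists>y\<in>D. dist x y < e"
      by blast
    have "countable (D \<inter> ball undefined (real n))" for n
    proof (rule countable_disjoint_positive_measure[where X = "\<lambda>y. ball y (e / 2)" and B = "ball undefined (real n + e)" and M = M])
      show "disjoint_family_on (\<lambda>y. ball y (e / 2)) (D \<inter> ball undefined (real n))"
        unfolding disjoint_family_on_def
      proof (intro ballI impI equals0I)
        fix x y z assume *: "x \<in> D \<inter> ball undefined (real n)" "y \<in> D \<inter> ball undefined (real n)" "x \<noteq> y"
          "z \<in> ball x (e / 2) \<inter> ball y (e / 2)"
        then show False
          using D(2)[of x y] dist_triangle2[of x y z] by (auto simp: dist_commute)
      qed
      show "ball undefined (real n + e) \<in> fmeasurable M"
        using ball M(2) by (intro fmeasurableI)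
      show "0 < emeasure M (ball y (e / 2))" if "y \<in> D \<inter> ball undefined (real n)" for y
        using that D(1) e by (auto simp: measure_support_def)
      show "ball y (e / 2) \<subseteq> ball undefined (real n + e)" if "y \<in> D \<inter> ball undefined (real n)" for y
      proof
        fix z assume "z \<in> ball y (e / 2)"
        then show "z \<in> ball undefined (real n + e)"
          using that e dist_triangle[of undefined z y] by auto
      qed
    qed (rule ball)
    then have "countable (\<Union>n. D \<inter> ball undefined (real n))"
      by (intro countable_UN) auto
    moreover have "(\<Union>n. D \<inter> ball undefined (real n)) = D"
      using reals_Archimedean2 by auto
    ultimately show ?thesis
      using D by auto
  qed
  from this[of "inverse (real (Suc n))" for n] obtain D where D: "\<And>n. countable (D n)" "\<And>n. D n \<subseteq> measure_support M"
    "\<And>n x. x \<in> measure_support M \<Longrightarrow> \<exists>y\<in>D n. dist x y < inverse (real (Suc n))"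
    by (metis inverse_positive_iff_positive of_nat_0_less_iff zero_less_Suc)
  show thesis
  proof (rule that[of "\<Union>n. D n"])
    fix x and r :: real assume x: "x \<in> measure_support M" and "0 < r"
    from reals_Archimedean[OF \<open>0 < r\<close>] obtain n where n: "inverse (real (Suc n)) < r"
      by blast
    from D(3)[OF x, of n] n show "\<exists>y\<in>\<Union>n. D n. dist x y < r"
      by (meson UN_I UNIV_I order_less_trans)
  qed (use D in auto)
qed

subsection \<open>The path distance to the complement\<close>

definition path_inf :: "('a::metric_space \<Rightarrow> ennreal) \<Rightarrow> ('a \<Rightarrow> ennreal) \<Rightarrow> 'a \<Rightarrow> ennreal" where
  "path_inf g F x = (INF (l, \<gamma>) \<in> {(l, \<gamma>). 0 \<le> l \<and> short_path \<gamma> \<and> \<gamma> 0 = x}. F (\<gamma> l) + line_integral l \<gamma> g)"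

lemma path_inf_le: "0 \<le> l \<Longrightarrow> short_path \<gamma> \<Longrightarrow> path_inf g F (\<gamma> 0) \<le> F (\<gamma> l) + line_integral l \<gamma> g"
  unfolding path_inf_def by (intro INF_lower2[of "(l, \<gamma>)"]) auto

lemma le_path_inf:
  assumes "\<And>l \<gamma>. 0 \<le> l \<Longrightarrow> short_path \<gamma> \<Longrightarrow> \<gamma> 0 = x \<Longrightarrow> c \<le> F (\<gamma> l) + line_integral l \<gamma> g"
  shows "c \<le> path_inf g F x"
  unfolding path_inf_def using assms by (auto intro!: INF_greatest)

lemma path_inf_less_iff:
  "path_inf g F x < c \<longleftrightarrow> (\<exists>l \<gamma>. 0 \<le> l \<and> short_path \<gamma> \<and> \<gamma> 0 = x \<and> F (\<gamma> l) + line_integral l \<gamma> g < c)"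
  unfolding path_inf_def by (auto simp: INF_less_iff)

lemma line_integral_0 [simp]: "line_integral 0 \<gamma> g = 0"
  unfolding line_integral_def by (rule nn_integral_null_set) auto

lemma path_inf_le_start: "path_inf g F x \<le> F x"
  using path_inf_le[of 0 "\<lambda>_. x" g F] by (simp add: short_path_def)

section \<open>Reversal and concatenation of paths\<close>

lemma short_path_borel: "short_path \<gamma> \<Longrightarrow> \<gamma> \<in> borel_measurable borel"
  by (intro borel_measurable_continuous_onI short_path_continuous)

lemma nn_integral_shift:
  fixes f :: "real \<Rightarrow> ennreal"
  assumes "f \<in> borel_measurable borel"
  shows "(\<integral>\<^sup>+t. f (t - c) \<partial>lborel) = (\<integral>\<^sup>+t. f t \<partial>lborel)"
  using nn_integral_real_affine[OF assms, of 1 "- c"] by (simp add: add.commute[of "- c"])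

lemma nn_integral_reflect:
  fixes f :: "real \<Rightarrow> ennreal"
  assumes "f \<in> borel_measurable borel"
  shows "(\<integral>\<^sup>+t. f (c - t) \<partial>lborel) = (\<integral>\<^sup>+t. f t \<partial>lborel)"
  using nn_integral_real_affine[OF assms, of "- 1" c] by simp

lemma short_path_reverse: "short_path \<gamma> \<Longrightarrow> short_path (\<lambda>t. \<gamma> (l - t))"
  unfolding short_path_def by (smt (verit, best))

lemma line_integral_reverse:
  assumes "short_path \<gamma>" "g \<in> borel_measurable borel"
  shows "line_integral l (\<lambda>t. \<gamma> (l - t)) g = line_integral l \<gamma> g"
proof -
  note [measurable] = short_path_borel[OF assms(1)] assms(2)
  have "line_integral l \<gamma> g = (\<integral>\<^sup>+t. g (\<gamma> (l - t)) * indicator {0..l} (l - t) \<partial>lborel)"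
    unfolding line_integral_def by (rule nn_integral_reflect[symmetric]) measurable
  also have "\<dots> = line_integral l (\<lambda>t. \<gamma> (l - t)) g"
    unfolding line_integral_def by (intro nn_integral_cong) (auto simp: indicator_def)
  finally show ?thesis ..
qed

lemma short_path_append:
  assumes "short_path \<gamma>" "short_path \<delta>" "\<gamma> l = \<delta> 0"
  shows "short_path (\<lambda>t. if t \<le> l then \<gamma> t else \<delta> (t - l))"
proof -
  have *: "dist (\<gamma> s) (\<delta> (t - l)) \<le> t - s" if "s \<le> l" "l < t" for s t
    using dist_triangle[of "\<gamma> s" "\<delta> (t - l)" "\<gamma> l"] short_path_dist_le[OF assms(1), of s l]
      short_path_dist_le[OF assms(2), of 0 "t - l"] assms(3) that by simp
  show ?thesis
    unfolding short_path_def
  proof (intro allI)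
    fix s t
    show "dist (if s \<le> l then \<gamma> s else \<delta> (s - l)) (if t \<le> l then \<gamma> t else \<delta> (t - l)) \<le> \<bar>s - t\<bar>"
      using short_pathD[OF assms(1), of s t] short_pathD[OF assms(2), of "s - l" "t - l"] *[of s t] *[of t s]
      by (auto simp: dist_commute)
  qed
qed

text \<open>Dynamic programming: running along \<open>\<gamma>\<close> and continuing with a
  competitor from \<open>\<gamma> l\<close> gives a competitor from \<open>\<gamma> 0\<close>. The
  finite line integral is moved to the left by subtraction, so that the infimum on the right can be
  bounded competitor by competitor.\<close>

lemma path_inf_along_path:
  assumes \<gamma>: "short_path \<gamma>" and l: "0 \<le> l" and g: "g \<in> borel_measurable borel"
  shows "path_inf g F (\<gamma> 0) \<le> line_integral l \<gamma> g + path_inf g F (\<gamma> l)"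
proof (cases "line_integral l \<gamma> g = top")
  case False
  have "path_inf g F (\<gamma> 0) - line_integral l \<gamma> g \<le> path_inf g F (\<gamma> l)"
  proof (rule le_path_inf)
    fix k :: real and \<delta> :: "real \<Rightarrow> 'a" assume \<delta>: "0 \<le> k" "short_path \<delta>" "\<delta> 0 = \<gamma> l"
    define \<eta> where "\<eta> t = (if t \<le> l then \<gamma> t else \<delta> (t - l))" for t
    note [measurable] = short_path_borel[OF \<gamma>] short_path_borel[OF \<delta>(2)] g
    have "short_path \<eta>"
      unfolding \<eta>_def[abs_def] using \<gamma> \<delta> by (intro short_path_append) auto
    then have "path_inf g F (\<eta> 0) \<le> F (\<eta> (l + k)) + line_integral (l + k) \<eta> g"
      using l \<delta> by (intro path_inf_le) auto
    moreover have "\<eta> 0 = \<gamma> 0" "\<eta> (l + k) = \<delta> k"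
      using l \<delta> by (auto simp: \<eta>_def)
    moreover have "line_integral (l + k) \<eta> g \<le> line_integral l \<gamma> g + line_integral k \<delta> g"
    proof -
      have "line_integral (l + k) \<eta> g \<le>
          (\<integral>\<^sup>+t. g (\<gamma> t) * indicator {0..l} t + g (\<delta> (t - l)) * indicator {0..k} (t - l) \<partial>lborel)"
        unfolding line_integral_def by (intro nn_integral_mono) (auto simp: \<eta>_def indicator_def)
      also have "\<dots> = line_integral l \<gamma> g + (\<integral>\<^sup>+t. g (\<delta> (t - l)) * indicator {0..k} (t - l) \<partial>lborel)"
        unfolding line_integral_def by (rule nn_integral_add) measurable
      also have "(\<integral>\<^sup>+t. g (\<delta> (t - l)) * indicator {0..k} (t - l) \<partial>lborel) = line_integral k \<delta> g"
        unfolding line_integral_def by (rule nn_integral_shift) measurable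
      finally show ?thesis .
    qed
    ultimately have "path_inf g F (\<gamma> 0) \<le> F (\<delta> k) + (line_integral l \<gamma> g + line_integral k \<delta> g)"
      by (auto intro: order_trans add_left_mono)
    also have "\<dots> = line_integral l \<gamma> g + (F (\<delta> k) + line_integral k \<delta> g)"
      by (simp add: ac_simps)
    finally have "path_inf g F (\<gamma> 0) \<le> line_integral l \<gamma> g + (F (\<delta> k) + line_integral k \<delta> g)" .
    then show "path_inf g F (\<gamma> 0) - line_integral l \<gamma> g \<le> F (\<delta> k) + line_integral k \<delta> g"
      using False by (simp add: ennreal_minus_le_iff)
  qed
  then show ?thesis
    using False by (simp add: ennreal_minus_le_iff)
qed simp

text \<open>An arc-length curve is specified on \<open>{0..l}\<close> alone; freezing it beyond the
  endpoints makes it a competitor in \<open>path_inf\<close>.\<close>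

lemma arc_length_curve_short:
  assumes "arc_length_curve l \<gamma>"
  obtains \<delta> where "short_path \<delta>" "\<And>t. t \<in> {0..l} \<Longrightarrow> \<delta> t = \<gamma> t" "0 \<le> l"
proof -
  have l: "0 < l" and len: "\<And>s t. 0 \<le> s \<Longrightarrow> s \<le> t \<Longrightarrow> t \<le> l \<Longrightarrow> curve_length \<gamma> s t = ennreal (t - s)"
    using assms by (auto simp: arc_length_curve_def)
  have "dist (\<gamma> s) (\<gamma> t) \<le> t - s" if "0 \<le> s" "s \<le> t" "t \<le> l" for s t
    using dist_le_curve_length[OF that(2), of \<gamma>] len[OF that] that by (simp add: ennreal_le_iff)
  then have "short_path (\<lambda>t. \<gamma> (max 0 (min l t)))"
    using l by (intro short_path_clamp) auto
  then show thesis
    by (rule that) (use l in auto)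
qed

lemma line_integral_cong:
  "(\<And>t. t \<in> {0..l} \<Longrightarrow> \<gamma> t = \<delta> t) \<Longrightarrow> line_integral l \<gamma> g = line_integral l \<delta> g"
  unfolding line_integral_def by (intro nn_integral_cong) (auto simp: indicator_def)

lemma path_inf_arc_length:
  assumes "arc_length_curve l \<gamma>" and g: "g \<in> borel_measurable borel"
  shows "path_inf g F (\<gamma> 0) \<le> line_integral l \<gamma> g + path_inf g F (\<gamma> l)"
    and "path_inf g F (\<gamma> l) \<le> line_integral l \<gamma> g + path_inf g F (\<gamma> 0)"
proof -
  from arc_length_curve_short[OF assms(1)] obtain \<delta> where \<delta>: "short_path \<delta>" "\<And>t. t \<in> {0..l} \<Longrightarrow> \<delta> t = \<gamma> t" "0 \<le> l"
    by blast
  have eq: "line_integral l \<delta> g = line_integral l \<gamma> g"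
    using \<delta>(2) by (rule line_integral_cong)
  show "path_inf g F (\<gamma> 0) \<le> line_integral l \<gamma> g + path_inf g F (\<gamma> l)"
    using path_inf_along_path[OF \<delta>(1,3) g, of F] \<delta>(2,3) eq by simp
  show "path_inf g F (\<gamma> l) \<le> line_integral l \<gamma> g + path_inf g F (\<gamma> 0)"
    using path_inf_along_path[OF short_path_reverse[OF \<delta>(1), of l] \<delta>(3) g, of F]
      line_integral_reverse[OF \<delta>(1) g, of l] \<delta>(2,3) eq by simp
qed

text \<open>Dynamic programming along the curve and along its reversal bounds the difference from
  both sides. Finiteness of \<open>F\<close> passes to the infimum, so the clause for infinite
  values never applies.\<close>

lemma upper_gradient_path_inf:
  assumes g: "g \<in> borel_measurable borel" and fin: "\<And>x. F x < \<infinity>"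
  shows "upper_gradient g (\<lambda>x. enn2ereal (path_inf g F x))"
  unfolding upper_gradient_def
proof (intro conjI allI impI)
  fix l and \<gamma> :: "real \<Rightarrow> 'a" assume \<gamma>: "arc_length_curve l \<gamma>"
  define a b where "a = enn2real (path_inf g F (\<gamma> 0))" and "b = enn2real (path_inf g F (\<gamma> l))"
  have "path_inf g F x < top" for x
    using path_inf_le_start[of g F x] fin[of x] by (simp add: le_less_trans)
  then have ab: "path_inf g F (\<gamma> 0) = ennreal a" "path_inf g F (\<gamma> l) = ennreal b" "0 \<le> a" "0 \<le> b"
    by (auto simp: a_def b_def)
  have "ennreal \<bar>a - b\<bar> \<le> line_integral l \<gamma> g"
  proof (cases "line_integral l \<gamma> g" rule: ennreal_cases)
    case (real r)
    then show ?thesis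
      using path_inf_arc_length[OF \<gamma> g, of F] ab by (simp flip: ennreal_plus add: ennreal_le_iff)
  qed simp
  moreover have "e2ennreal \<bar>ereal a - ereal b\<bar> = ennreal \<bar>a - b\<bar>"
    by (simp add: e2ennreal_ereal)
  ultimately show "(if \<bar>enn2ereal (path_inf g F (\<gamma> 0))\<bar> = \<infinity> \<or> \<bar>enn2ereal (path_inf g F (\<gamma> l))\<bar> = \<infinity> then \<infinity>
      else e2ennreal \<bar>enn2ereal (path_inf g F (\<gamma> 0)) - enn2ereal (path_inf g F (\<gamma> l))\<bar>) \<le> line_integral l \<gamma> g"
    using ab by simp
qed (rule g)

subsection \<open>Positivity on path-open sets\<close>

text \<open>The tent \<open>max 0 (l - \<bar>t - m\<bar>)\<close> runs \<open>\<gamma>\<close> out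
  to \<open>\<gamma> l\<close> and back within the window of radius \<open>l\<close> about
  \<open>m\<close>. Each half is a shift or a reflection of one traversal.\<close>

lemma line_integral_loop:
  fixes \<gamma> :: "real \<Rightarrow> 'a::metric_space"
  assumes \<gamma>: "short_path \<gamma>" and g: "g \<in> borel_measurable borel"
  shows "(\<integral>\<^sup>+t. g (\<gamma> (max 0 (l - \<bar>t - m\<bar>))) * indicator {m - l..m + l} t \<partial>lborel) \<le> 2 * line_integral l \<gamma> g"
proof -
  note [measurable] = short_path_borel[OF \<gamma>] g
  define h where "h t = g (\<gamma> t) * indicator {0..l} t" for t
  have [measurable]: "h \<in> borel_measurable borel"
    unfolding h_def by measurable
  have "(\<integral>\<^sup>+t. g (\<gamma> (max 0 (l - \<bar>t - m\<bar>))) * indicator {m - l..m + l} t \<partial>lborel) \<le>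
      (\<integral>\<^sup>+t. h (t - (m - l)) + h ((m + l) - t) \<partial>lborel)"
  proof (rule nn_integral_mono)
    fix t
    have eq: "l - (t - m) = (m + l) - t" "l - (m - t) = t - (m - l)"
      by simp_all
    show "g (\<gamma> (max 0 (l - \<bar>t - m\<bar>))) * indicator {m - l..m + l} t \<le> h (t - (m - l)) + h ((m + l) - t)"
    proof (cases "t \<in> {m - l..m + l}")
      case True
      show ?thesis
      proof (cases "t \<le> m")
        case True
        with \<open>t \<in> {m - l..m + l}\<close> have e: "max 0 (l - \<bar>t - m\<bar>) = t - (m - l)" "t - (m - l) \<in> {0..l}"
          by auto
        have "g (\<gamma> (max 0 (l - \<bar>t - m\<bar>))) * indicator {m - l..m + l} t \<le> h (t - (m - l))"
          unfolding e(1) h_def using e(2) by (simp add: indicator_def)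
        then show ?thesis
          by (rule order_trans) simp
      next
        case False
        with \<open>t \<in> {m - l..m + l}\<close> have e: "max 0 (l - \<bar>t - m\<bar>) = (m + l) - t" "(m + l) - t \<in> {0..l}"
          by auto
        have "g (\<gamma> (max 0 (l - \<bar>t - m\<bar>))) * indicator {m - l..m + l} t \<le> h ((m + l) - t)"
          unfolding e(1) h_def using e(2) by (simp add: indicator_def)
        then show ?thesis
          by (rule order_trans) simp
      qed
    qed simp
  qed
  also have "\<dots> = (\<integral>\<^sup>+t. h (t - (m - l)) \<partial>lborel) + (\<integral>\<^sup>+t. h ((m + l) - t) \<partial>lborel)"
    by (rule nn_integral_add) measurable
  also have "\<dots> = (\<integral>\<^sup>+t. h t \<partial>lborel) + (\<integral>\<^sup>+t. h t \<partial>lborel)"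
    by (simp only: nn_integral_shift[OF \<open>h \<in> borel_measurable borel\<close>] nn_integral_reflect[OF \<open>h \<in> borel_measurable borel\<close>])
  finally show ?thesis
    unfolding h_def line_integral_def by (simp add: mult_2)
qed

text \<open>The loops occupy consecutive intervals \<open>{a (Suc i)..a i}\<close>, later indices at
  earlier times, so that they accumulate at time 0. Summability of the lengths makes the total time
  finite, and the pieces fit together because every loop is based at \<open>x\<close>.\<close>

lemma concat_loops:
  fixes \<gamma> :: "nat \<Rightarrow> real \<Rightarrow> 'a::metric_space"
  assumes \<gamma>: "\<And>i. short_path (\<gamma> i)" "\<And>i. \<gamma> i 0 = x" and l: "\<And>i. 0 < l i" and sum: "summable l"
    and g: "g \<in> borel_measurable borel"
  obtains \<Gamma> L m where "short_path \<Gamma>" "0 < L" "\<And>i. m i \<in> {0..L}" "m \<longlonglongrightarrow> 0" "\<Gamma> 0 = x" "\<And>i. \<Gamma> (m i) = \<gamma> i (l i)"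
    "line_integral L \<Gamma> g \<le> (\<Sum>i. 2 * line_integral (l i) (\<gamma> i) g)"
proof -
  \<comment> \<open>\<open>a i\<close> is the total duration of the loops with index at least
    \<open>i\<close>; loop \<open>i\<close> lasts \<open>2 * l i\<close>, out and back, and
    \<open>m i\<close> below is its turning time.\<close>
  define a where "a i = (\<Sum>k. 2 * l (k + i))" for i
  have sum2: "summable (\<lambda>k. 2 * l (k + i))" for i
    using sum by (intro summable_mult summable_ignore_initial_segment)
  have a_Suc: "a i = 2 * l i + a (Suc i)" for i
    using suminf_split_head[OF sum2[of i]] by (simp add: a_def)
  have a_nonneg: "0 \<le> a i" for i
    unfolding a_def using l sum2 by (intro suminf_nonneg) (auto intro: less_imp_le)
  have a_lim: "a \<longlonglongrightarrow> 0"
  proof -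
    have "a = (\<lambda>i. 2 * ((\<Sum>k. l k) - (\<Sum>k<i. l k)))"
      unfolding a_def[abs_def] using sum
      by (simp add: suminf_mult summable_ignore_initial_segment suminf_minus_initial_segment)
    moreover have "(\<lambda>i. 2 * ((\<Sum>k. l k) - (\<Sum>k<i. l k))) \<longlonglongrightarrow> 2 * ((\<Sum>k. l k) - (\<Sum>k. l k))"
      using sum by (intro tendsto_intros summable_LIMSEQ)
    ultimately show ?thesis
      by simp
  qed
  have a_dec: "a (Suc i) < a i" for i
    using a_Suc[of i] l[of i] by simp
  have a_anti: "a j \<le> a i" if "i \<le> j" for i j
    using lift_Suc_antimono_le[of a i j] a_dec that by (auto intro: less_imp_le)
  define m where "m i = a (Suc i) + l i" for i
  have ml: "m i - l i = a (Suc i)" "m i + l i = a i" for i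
    using a_Suc[of i] by (auto simp: m_def)
  define \<beta> where "\<beta> i t = \<gamma> i (max 0 (l i - \<bar>t - m i\<bar>))" for i t
  have \<beta>_short: "short_path (\<beta> i)" for i
    unfolding short_path_def
  proof (intro allI)
    fix s t
    have "dist (\<beta> i s) (\<beta> i t) \<le> \<bar>max 0 (l i - \<bar>s - m i\<bar>) - max 0 (l i - \<bar>t - m i\<bar>)\<bar>"
      unfolding \<beta>_def by (rule short_pathD[OF \<gamma>(1)])
    also have "\<dots> \<le> \<bar>s - t\<bar>"
      by linarith
    finally show "dist (\<beta> i s) (\<beta> i t) \<le> \<bar>s - t\<bar>" .
  qed
  have \<beta>_end: "\<beta> i (a i) = x" "\<beta> i (a (Suc i)) = x" for i
    using ml[of i] l[of i] \<gamma>(2)[of i] by (auto simp: \<beta>_def simp flip: ml)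
  have ex_piece: "\<exists>i. a (Suc i) < t \<and> t \<le> a i" if "0 < t" "t \<le> a 0" for t
  proof -
    have "\<forall>\<^sub>F i in sequentially. a i < t"
      using a_lim that by (intro order_tendstoD)
    then obtain i where "a i < t"
      by (auto simp: eventually_sequentially)
    then have least: "a (LEAST i. a i < t) < t"
      by (rule LeastI)
    then have "(LEAST i. a i < t) \<noteq> 0"
      using that by (metis not_less)
    then obtain k where k: "(LEAST i. a i < t) = Suc k"
      by (metis not0_implies_Suc)
    moreover have "\<not> a k < t"
      using k by (intro not_less_Least) simp
    ultimately show ?thesis
      using least by auto
  qed
  have uniq: "i = j" if "a (Suc i) < t" "t \<le> a i" "a (Suc j) < t" "t \<le> a j" for i j t
    using a_anti[of "Suc i" j] a_anti[of "Suc j" i] that by (cases i j rule: linorder_cases) auto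
  define \<Gamma> where "\<Gamma> t = (if 0 < t \<and> t \<le> a 0 then \<beta> (THE i. a (Suc i) < t \<and> t \<le> a i) t else x)" for t
  have \<Gamma>: "\<Gamma> t = \<beta> i t" if "a (Suc i) < t" "t \<le> a i" for t i
  proof -
    have "(THE i. a (Suc i) < t \<and> t \<le> a i) = i"
      using that uniq by (intro the_equality) auto
    moreover have "0 < t" "t \<le> a 0"
      using that a_nonneg[of "Suc i"] a_anti[of 0 i] by auto
    ultimately show ?thesis
      by (simp add: \<Gamma>_def)
  qed
  have \<Gamma>_out: "\<Gamma> t = x" if "t \<le> 0 \<or> a 0 < t" for t
    using that by (auto simp: \<Gamma>_def)
  \<comment> \<open>The loop running at time \<open>t\<close> is back at \<open>x\<close> by its end
    \<open>a i\<close>, so the remaining time bounds the distance to \<open>x\<close>; outside all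
    loops the path rests at \<open>x\<close>. Points on different loops are compared through
    \<open>x\<close>.\<close>
  have right: "dist (\<Gamma> t) x \<le> u - t" if "t \<le> u" "\<And>i. a (Suc i) < t \<Longrightarrow> t \<le> a i \<Longrightarrow> a i \<le> u" for t u
  proof (cases "0 < t \<and> t \<le> a 0")
    case True
    then obtain i where i: "a (Suc i) < t" "t \<le> a i"
      using ex_piece by blast
    have "dist (\<Gamma> t) x \<le> a i - t"
      using short_path_dist_le[OF \<beta>_short i(2), of i] \<beta>_end[of i] \<Gamma>[OF i] by simp
    also have "\<dots> \<le> u - t"
      using that(2)[OF i] by simp
    finally show ?thesis .
  next
    case False
    then show ?thesis
      using that(1) \<Gamma>_out[of t] by (simp add: not_le not_less)
  qed
  have short_\<Gamma>: "dist (\<Gamma> s) (\<Gamma> t) \<le> t - s" if "s \<le> t" for s t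
  proof (cases "0 < t \<and> t \<le> a 0")
    case True
    then obtain i where i: "a (Suc i) < t" "t \<le> a i"
      using ex_piece by blast
    show ?thesis
    proof (cases "a (Suc i) < s")
      case True
      then show ?thesis
        using short_path_dist_le[OF \<beta>_short that, of i] \<Gamma>[OF i] \<Gamma>[of i s] i that by simp
    next
      case False
      have "dist (\<Gamma> s) x \<le> a (Suc i) - s"
      proof (rule right)
        show "a j \<le> a (Suc i)" if j: "a (Suc j) < s" "s \<le> a j" for j
        proof (rule ccontr)
          assume "\<not> ?thesis"
          then have "j < Suc i"
            using a_anti[of "Suc i" j] by (cases "j < Suc i") auto
          then have "a (Suc i) \<le> a (Suc j)"
            by (intro a_anti) simp
          then show False
            using j False by simp
        qed
      qed (use False in simp)
      moreover have "dist x (\<Gamma> t) \<le> t - a (Suc i)"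
        using short_path_dist_le[OF \<beta>_short less_imp_le[OF i(1)], of i] \<beta>_end(2)[of i] \<Gamma>[OF i] by simp
      ultimately show ?thesis
        using dist_triangle[of "\<Gamma> s" "\<Gamma> t" x] by simp
    qed
  next
    case False
    show ?thesis
    proof (cases "t \<le> 0")
      case True
      then show ?thesis
        using that \<Gamma>_out[of s] \<Gamma>_out[of t] by simp
    next
      case F: False
      have "dist (\<Gamma> s) x \<le> t - s"
      proof (rule right[OF that])
        show "a j \<le> t" if "a (Suc j) < s" "s \<le> a j" for j
          using a_anti[of 0 j] False F by simp
      qed
      then show ?thesis
        using False F \<Gamma>_out[of t] by simp
    qed
  qed
  show thesis
  proof (rule that[of \<Gamma> "a 0" m])
    show "short_path \<Gamma>"
      unfolding short_path_def
    proof (intro allI)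
      fix s t
      show "dist (\<Gamma> s) (\<Gamma> t) \<le> \<bar>s - t\<bar>"
        using short_\<Gamma>[of s t] short_\<Gamma>[of t s] by (cases "s \<le> t") (auto simp: dist_commute)
    qed
    show "0 < a 0"
      using a_nonneg[of 1] a_Suc[of 0] l[of 0] by simp
    have m_in: "a (Suc i) < m i" "m i \<le> a i" for i
      using l[of i] ml[of i] by auto
    show "m i \<in> {0..a 0}" for i
      using m_in[of i] a_nonneg[of "Suc i"] a_anti[of 0 i] by simp
    show "m \<longlonglongrightarrow> 0"
    proof (rule tendsto_sandwich[OF _ _ tendsto_const a_lim])
      show "\<forall>\<^sub>F i in sequentially. 0 \<le> m i"
        using m_in(1) a_nonneg by (intro always_eventually allI) (meson less_imp_le order_trans)
      show "\<forall>\<^sub>F i in sequentially. m i \<le> a i"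
        using m_in(2) by (intro always_eventually allI)
    qed
    show "\<Gamma> 0 = x"
      by (simp add: \<Gamma>_out)
    show "\<Gamma> (m i) = \<gamma> i (l i)" for i
      using \<Gamma>[OF m_in[of i]] l[of i] by (simp add: \<beta>_def max_def)
    have "line_integral (a 0) \<Gamma> g \<le> (\<integral>\<^sup>+t. (\<Sum>i. g (\<beta> i t) * indicator {m i - l i..m i + l i} t) \<partial>lborel)"
      unfolding line_integral_def
    proof (rule nn_integral_mono_AE)
      \<comment> \<open>Time 0, where the loops accumulate, belongs to no piece; it is a null
        set.\<close>
      have "AE t in lborel. t \<noteq> (0::real)"
        by (rule AE_lborel_singleton)
      then show "AE t in lborel. g (\<Gamma> t) * indicator {0..a 0} t \<le> (\<Sum>i. g (\<beta> i t) * indicator {m i - l i..m i + l i} t)"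
      proof eventually_elim
        case (elim t)
        show ?case
        proof (cases "0 < t \<and> t \<le> a 0")
          case True
          then obtain i where i: "a (Suc i) < t" "t \<le> a i"
            using ex_piece by blast
          have "g (\<Gamma> t) * indicator {0..a 0} t = (\<Sum>i\<in>{i}. g (\<beta> i t) * indicator {m i - l i..m i + l i} t)"
            using True i \<Gamma>[OF i] ml[of i] by simp
          also have "\<dots> \<le> (\<Sum>i. g (\<beta> i t) * indicator {m i - l i..m i + l i} t)"
            by (intro sum_le_suminf) auto
          finally show ?thesis .
        next
          case False
          then show ?thesis
            using elim by (auto simp: indicator_def)
        qed
      qed
    qed
    also have "\<dots> = (\<Sum>i. \<integral>\<^sup>+t. g (\<beta> i t) * indicator {m i - l i..m i + l i} t \<partial>lborel)"
    proof (rule nn_integral_suminf)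
      fix i
      note [measurable] = short_path_borel[OF \<beta>_short[of i]] g
      show "(\<lambda>t. g (\<beta> i t) * indicator {m i - l i..m i + l i} t) \<in> borel_measurable lborel"
        by measurable
    qed
    also have "\<dots> \<le> (\<Sum>i. 2 * line_integral (l i) (\<gamma> i) g)"
      unfolding \<beta>_def by (intro suminf_le line_integral_loop \<gamma> g) auto
    finally show "line_integral (a 0) \<Gamma> g \<le> (\<Sum>i. 2 * line_integral (l i) (\<gamma> i) g)" .
  qed
qed

text \<open>Value 0 at \<open>x\<close> yields paths of cost below \<open>c * (1/2)^i\<close>. As
  \<open>g \<ge> c\<close> on the unit ball, they are shorter than \<open>(1/2)^i\<close> and end
  inside the ball, and as \<open>F \<ge> c\<close> on \<open>U\<close> there, they end outside
  \<open>U\<close>. Lengths and costs are thus both summable, as the concatenation requires.\<close>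

lemma path_inf_pos:
  fixes U :: "'a::metric_space set"
  assumes g: "g \<in> borel_measurable borel" and \<rho>: "\<rho> \<in> borel_measurable borel" "\<And>y. \<rho> y \<le> g y"
    and c: "0 < c" "\<And>y. y \<in> ball x 1 \<Longrightarrow> ennreal c \<le> g y" "\<And>y. y \<in> ball x 1 \<inter> U \<Longrightarrow> ennreal c \<le> F y"
    and open_curve: "\<And>l \<gamma>. arc_length_curve l \<gamma> \<Longrightarrow> line_integral l \<gamma> \<rho> < \<infinity> \<Longrightarrow>
      openin (top_of_set {0..l}) {t \<in> {0..l}. \<gamma> t \<in> U}"
    and x: "x \<in> U"
  shows "0 < path_inf g F x"
proof (rule ccontr)
  assume "\<not> ?thesis"
  then have inf0: "path_inf g F x = 0"
    by simp
  define Q where "Q i l \<gamma> \<longleftrightarrow> 0 < l \<and> l < (1/2) ^ i \<and> short_path \<gamma> \<and> \<gamma> 0 = x \<and> \<gamma> l \<notin> U \<and>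
    line_integral l \<gamma> g \<le> ennreal (c * (1/2) ^ i)" for i :: nat and l \<gamma>
  have "\<exists>l \<gamma>. Q i l \<gamma>" for i
  proof -
    define r where "r = (1/2 :: real) ^ i"
    have r: "0 < r" "r \<le> 1"
      by (auto simp: r_def power_le_one)
    have "path_inf g F x < ennreal (c * r)"
      using inf0 c r by simp
    then obtain l \<gamma> where l: "0 \<le> l" "short_path \<gamma>" "\<gamma> 0 = x" "F (\<gamma> l) + line_integral l \<gamma> g < ennreal (c * r)"
      unfolding path_inf_less_iff by blast
    have F_less: "F (\<gamma> l) < ennreal (c * r)" and I_less: "line_integral l \<gamma> g < ennreal (c * r)"
      using l(4) by (meson le_less_trans add_increasing add_increasing2 order_refl zero_le)+
    have near: "\<gamma> t \<in> ball x 1" if "0 \<le> t" "t < r" for t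
      using short_path_dist_le[OF l(2) that(1)] l(3) that(2) r by simp
    \<comment> \<open>A path that lasts until time \<open>r\<close> stays in the unit ball up to
      then, where \<open>g \<ge> c\<close>, and so costs at least \<open>c * r\<close>.\<close>
    have "l < r"
    proof (rule ccontr)
      assume "\<not> l < r"
      have "ennreal (c * r) = (\<integral>\<^sup>+t. ennreal c * indicator {0..<r} t \<partial>lborel)"
        using c r by (simp add: nn_integral_cmult ennreal_mult)
      also have "\<dots> \<le> line_integral l \<gamma> g"
        unfolding line_integral_def using \<open>\<not> l < r\<close> c(2) near
        by (intro nn_integral_mono) (auto simp: indicator_def)
      finally show False
        using I_less by simp
    qed
    moreover have "\<gamma> l \<notin> U"
    proof
      assume "\<gamma> l \<in> U"
      with near[OF l(1) \<open>l < r\<close>] have "ennreal c \<le> F (\<gamma> l)"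
        by (intro c(3)) simp
      then have "ennreal c < ennreal (c * r)"
        using F_less by simp
      then show False
        using c(1) r by (simp add: ennreal_less_iff)
    qed
    moreover have "l \<noteq> 0"
      using \<open>\<gamma> l \<notin> U\<close> l(3) x by auto
    ultimately show ?thesis
      using l(1-3) I_less unfolding r_def Q_def by (intro exI[of _ l] exI[of _ \<gamma>]) auto
  qed
  then obtain l \<gamma> where "\<And>i. Q i (l i) (\<gamma> i)"
    by metis
  then have l: "\<And>i. 0 < l i" "\<And>i. l i < (1/2) ^ i" and \<gamma>: "\<And>i. short_path (\<gamma> i)" "\<And>i. \<gamma> i 0 = x"
    "\<And>i. \<gamma> i (l i) \<notin> U" "\<And>i. line_integral (l i) (\<gamma> i) g \<le> ennreal (c * (1/2) ^ i)"
    unfolding Q_def by blast+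
  have sum: "summable l"
    by (rule summable_comparison_test'[OF summable_geometric[of "1/2"], of 0])
      (use l in \<open>auto intro: less_imp_le simp: abs_of_pos\<close>)
  obtain \<Gamma> L m where \<Gamma>: "short_path \<Gamma>" "0 < L" "\<And>i. m i \<in> {0..L}" "m \<longlonglongrightarrow> 0" "\<Gamma> 0 = x" "\<And>i. \<Gamma> (m i) = \<gamma> i (l i)"
    "line_integral L \<Gamma> g \<le> (\<Sum>i. 2 * line_integral (l i) (\<gamma> i) g)"
    by (rule concat_loops[OF \<gamma>(1,2) l(1) sum g]) (rule that; assumption)
  have "(\<Sum>i. 2 * line_integral (l i) (\<gamma> i) g) \<le> (\<Sum>i. ennreal (2 * c * (1/2) ^ i))"
  proof (rule suminf_le)
    fix i
    have "2 * line_integral (l i) (\<gamma> i) g \<le> ennreal 2 * ennreal (c * (1/2) ^ i)"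
      using \<gamma>(4)[of i] by (intro mult_mono) auto
    also have "\<dots> = ennreal (2 * c * (1/2) ^ i)"
      using c(1) by (subst ennreal_mult[symmetric]) auto
    finally show "2 * line_integral (l i) (\<gamma> i) g \<le> ennreal (2 * c * (1/2) ^ i)" .
  qed auto
  also have "\<dots> = ennreal (2 * c * 2)"
    using geometric_sums[of "1/2 :: real"] c(1) by (intro suminf_ennreal_eq sums_mult) auto
  also have "\<dots> < \<infinity>"
    by simp
  finally have fin: "line_integral L \<Gamma> g < \<infinity>"
    using \<Gamma>(7) by (rule le_less_trans[rotated])
  \<comment> \<open>Arc-length parametrization requires a nonconstant path; the loops do leave
    \<open>x\<close>, since they reach points outside \<open>U\<close>.\<close>
  have "\<Gamma> (m 0) \<noteq> \<Gamma> 0"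
    using \<Gamma>(5) \<Gamma>(6)[of 0] \<gamma>(3)[of 0] x by auto
  then have "\<exists>t\<in>{0..L}. \<Gamma> t \<noteq> \<Gamma> 0"
    using \<Gamma>(3) by blast
  then obtain \<delta> s where s: "mono s" "\<And>a b. \<bar>s a - s b\<bar> \<le> \<bar>a - b\<bar>" "s 0 = 0" and \<delta>: "arc_length_curve (s L) \<delta>"
    "short_path \<delta>" "\<And>t. t \<in> {0..L} \<Longrightarrow> \<delta> (s t) = \<Gamma> t"
    by (rule arc_length_reparametrization[OF \<Gamma>(1,2)]) (rule that; assumption)
  note [measurable] = short_path_borel[OF \<delta>(2)] \<rho>(1)
  have "line_integral (s L) \<delta> \<rho> \<le> (\<integral>\<^sup>+t\<in>{0..L}. \<rho> (\<delta> (s t)) \<partial>lborel)"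
    unfolding line_integral_def by (rule nn_integral_short_substitution[OF s \<Gamma>(2)]) measurable
  also have "\<dots> \<le> line_integral L \<Gamma> g"
    unfolding line_integral_def using \<rho>(2) \<delta>(3) by (intro nn_integral_mono) (auto simp: indicator_def)
  finally have "line_integral (s L) \<delta> \<rho> < \<infinity>"
    using fin by (rule le_less_trans)
  from open_curve[OF \<delta>(1) this] obtain T where T: "open T" "{t \<in> {0..s L}. \<delta> t \<in> U} = {0..s L} \<inter> T"
    by (auto simp: openin_open)
  have s_in: "s t \<in> {0..s L}" if "t \<in> {0..L}" for t
    using monoD[OF s(1), of 0 t] monoD[OF s(1), of t L] s(3) that by auto
  have "\<delta> 0 \<in> U"
    using \<delta>(3)[of 0] \<Gamma>(2,5) s(3) x by simp
  then have "0 \<in> T"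
    using T(2) s_in[of 0] s(3) \<Gamma>(2) by auto
  \<comment> \<open>\<open>s\<close> is 1-Lipschitz with \<open>s 0 = 0\<close>, so the turning
    times still tend to 0 after reparametrization.\<close>
  have "(\<lambda>i. s (m i)) \<longlonglongrightarrow> 0"
  proof (rule tendsto_0_le[OF \<Gamma>(4), of _ 1])
    show "\<forall>\<^sub>F i in sequentially. norm (s (m i)) \<le> norm (m i) * 1"
      using s(2)[of _ 0] s(3) by (intro always_eventually) simp
  qed
  then have "\<forall>\<^sub>F i in sequentially. s (m i) \<in> T"
    using T(1) \<open>0 \<in> T\<close> by (rule topological_tendstoD)
  then obtain i where "s (m i) \<in> T"
    by (auto simp: eventually_sequentially)
  then have "\<delta> (s (m i)) \<in> U"
    using T(2) s_in[OF \<Gamma>(3)[of i]] by blast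
  then show False
    using \<delta>(3)[OF \<Gamma>(3)[of i]] \<Gamma>(6)[of i] \<gamma>(3)[of i] by simp
qed

subsection \<open>Measurability\<close>

text \<open>A witness for \<open>x \<in> A\<close> is a preimage \<open>y\<close>; its label
  \<open>i\<close> names a point of a countable dense set within \<open>(1/2)^i\<close>. Witnesses
  with stabilizing labels form a Cauchy sequence in \<open>Y\<close>, and continuity sends its limit
  to \<open>x\<close>.\<close>

lemma suslin_op_analytic_in:
  fixes A :: "'a::metric_space set"
  assumes "analytic_in S A"
  obtains F where "\<And>s. closed (F s)" "A = suslin_op F"
proof -
  from assms obtain Y :: "real set" and d and f :: "real \<Rightarrow> 'a" where
    ms: "Metric_space Y d" and complete: "Metric_space.mcomplete Y d"
    and sep: "separable_space (Metric_space.mtopology Y d)"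
    and cont: "continuous_map (Metric_space.mtopology Y d) (top_of_set S) f" and A: "f ` Y = A"
    by (auto simp: analytic_in_def)
  interpret Metric_space Y d by fact
  from sep obtain C where C: "countable C" "C \<subseteq> Y" "mtopology closure_of C = Y"
    by (auto simp: separable_space_def)
  define c where "c = from_nat_into C"
  have c_in: "c n \<in> Y" if "Y \<noteq> {}" for n
    using that C(2,3) from_nat_into[of C n] unfolding c_def by (metis closure_of_empty subsetD)
  have dense: "\<exists>n. d (c n) y < r" if y: "y \<in> Y" "0 < r" for y r
  proof -
    from y C(3) obtain z where z: "z \<in> C" "d y z < r"
      unfolding metric_closure_of by auto
    then obtain n where "c n = z"
      using from_nat_into_surj[OF C(1)] unfolding c_def by blast
    with z show ?thesis
      using commute by metis
  qed
  define lab where "lab i y = (LEAST n. d (c n) y < (1/2) ^ i)" for i y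
  have lab: "d (c (lab i y)) y < (1/2) ^ i" if "y \<in> Y" for i y
    unfolding lab_def by (rule LeastI_ex) (use that in \<open>intro dense; simp\<close>)
  have "\<exists>F. (\<forall>s. closed (F s)) \<and> {x. \<exists>y. y \<in> Y \<and> f y = x} = suslin_op F"
  proof (rule suslin_op_projection[where lab = lab])
    fix x X b \<sigma>
    assume X: "X \<longlonglongrightarrow> x" and b: "\<And>k. b k \<in> Y \<and> f (b k) = X k" and \<sigma>: "\<And>i k. i < k \<Longrightarrow> lab i (b k) = \<sigma> i"
    have "MCauchy b"
      unfolding MCauchy_def
    proof (intro conjI allI impI)
      show "range b \<subseteq> Y"
        using b by blast
      fix e :: real assume e: "0 < e"
      then obtain i where i: "(1/2) ^ i < e / 2"
        using real_arch_pow_inv[of "e / 2" "1/2"] by auto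
      show "\<exists>N. \<forall>n n'. N \<le> n \<longrightarrow> N \<le> n' \<longrightarrow> d (b n) (b n') < e"
      proof (intro exI allI impI)
        fix n n' assume n: "Suc i \<le> n" "Suc i \<le> n'"
        have "d (c (\<sigma> i)) (b n) < (1/2) ^ i" "d (c (\<sigma> i)) (b n') < (1/2) ^ i"
          using lab[of "b n" i] lab[of "b n'" i] \<sigma>[of i n] \<sigma>[of i n'] b n by auto
        moreover have "d (b n) (b n') \<le> d (b n) (c (\<sigma> i)) + d (c (\<sigma> i)) (b n')"
          using b c_in by (intro triangle) auto
        ultimately show "d (b n) (b n') < e"
          using i commute[of "b n" "c (\<sigma> i)"] by simp
      qed
    qed
    then obtain y where y: "limitin mtopology b y sequentially"
      using complete unfolding mcomplete_def by blast
    then have "limitin (top_of_set S) (f \<circ> b) (f y) sequentially"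
      by (rule continuous_map_limit[OF cont])
    then have "(f \<circ> b) \<longlonglongrightarrow> f y"
      by (simp add: limitin_subtopology)
    moreover have "f \<circ> b = X"
      using b by auto
    ultimately have "f y = x"
      using X LIMSEQ_unique by blast
    moreover have "y \<in> Y"
      using limitin_topspace[OF y] by simp
    ultimately show "\<exists>y. y \<in> Y \<and> f y = x"
      by blast
  qed
  moreover have "{x. \<exists>y. y \<in> Y \<and> f y = x} = A"
    using A by blast
  ultimately show thesis
    using that by metis
qed

lemma suslin_op_const: "suslin_op (\<lambda>_. A) = A"
  by (simp add: suslin_op_def)

text \<open>Fatou's lemma on top of the pointwise bound that lower semicontinuity gives along the
  converging paths.\<close>

lemma line_integral_le_liminf:
  fixes \<gamma> :: "nat \<Rightarrow> real \<Rightarrow> 'a::metric_space"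
  assumes g: "lsc g" and \<gamma>: "\<And>k. short_path (\<gamma> k)" and lim: "\<And>t. (\<lambda>k. \<gamma> k t) \<longlonglongrightarrow> \<delta> t" "l \<longlonglongrightarrow> l0"
  shows "line_integral l0 \<delta> g \<le> liminf (\<lambda>k. line_integral (l k) (\<gamma> k) g)"
proof -
  have "line_integral l0 \<delta> g \<le> (\<integral>\<^sup>+t. liminf (\<lambda>k. g (\<gamma> k t) * indicator {0..l k} t) \<partial>lborel)"
    unfolding line_integral_def
  proof (rule nn_integral_mono_AE)
    \<comment> \<open>For \<open>t < l0\<close> eventually \<open>t < l k\<close>, but at
      \<open>t = l0\<close> all the \<open>l k\<close> may be smaller; this single time is
      discarded.\<close>
    have "AE t in lborel. t \<noteq> l0"
      by (rule AE_lborel_singleton)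
    then show "AE t in lborel. g (\<delta> t) * indicator {0..l0} t \<le> liminf (\<lambda>k. g (\<gamma> k t) * indicator {0..l k} t)"
    proof eventually_elim
      case (elim t)
      show ?case
      proof (cases "t \<in> {0..l0}")
        case True
        with elim have "\<forall>\<^sub>F k in sequentially. t < l k"
          by (intro order_tendstoD(1)[OF lim(2)]) auto
        then have "\<forall>\<^sub>F k in sequentially. g (\<gamma> k t) = g (\<gamma> k t) * indicator {0..l k} t"
          by eventually_elim (use True in \<open>simp add: indicator_def\<close>)
        then have "liminf (\<lambda>k. g (\<gamma> k t)) = liminf (\<lambda>k. g (\<gamma> k t) * indicator {0..l k} t)"
          by (rule Liminf_eq)
        moreover have "g (\<delta> t) \<le> liminf (\<lambda>k. g (\<gamma> k t))"
          by (rule lsc_le_liminf[OF g lim(1)])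
        ultimately show ?thesis
          using True by simp
      qed simp
    qed
  qed
  also have "\<dots> \<le> liminf (\<lambda>k. line_integral (l k) (\<gamma> k) g)"
    unfolding line_integral_def
  proof (rule nn_integral_liminf)
    fix k
    note [measurable] = short_path_borel[OF \<gamma>[of k]] lsc_borel[OF g]
    show "(\<lambda>t. g (\<gamma> k t) * indicator {0..l k} t) \<in> borel_measurable lborel"
      by measurable
  qed
  finally show ?thesis .
qed

lemma add_le_of_liminf:
  fixes u v :: "nat \<Rightarrow> ennreal"
  assumes "a \<le> liminf u" "b \<le> liminf v" "\<And>k. u k + v k \<le> c"
  shows "a + b \<le> c"
proof -
  have mono: "incseq (\<lambda>n. INF m\<in>{n..}. w m)" for w :: "nat \<Rightarrow> ennreal"
    by (intro monoI INF_superset_mono) auto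
  have "a + b \<le> (SUP n. INF m\<in>{n..}. u m) + (SUP n. INF m\<in>{n..}. v m)"
    using add_mono[OF assms(1,2)] by (simp add: liminf_SUP_INF)
  also have "\<dots> = (SUP n. (INF m\<in>{n..}. u m) + (INF m\<in>{n..}. v m))"
    by (rule ennreal_SUP_add[symmetric]) (rule mono)+
  also have "\<dots> \<le> c"
  proof (rule SUP_least)
    fix n :: nat
    have "(INF m\<in>{n..}. u m) + (INF m\<in>{n..}. v m) \<le> u n + v n"
      by (intro add_mono INF_lower) auto
    then show "(INF m\<in>{n..}. u m) + (INF m\<in>{n..}. v m) \<le> c"
      using assms(3) by (rule order_trans)
  qed
  finally show ?thesis .
qed

lemma abs_diff_le_of_floor_eq:
  fixes a b :: real
  assumes "\<lfloor>a * 2 ^ i\<rfloor> = \<lfloor>b * 2 ^ i\<rfloor>"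
  shows "\<bar>a - b\<bar> \<le> (1/2) ^ i"
proof -
  have "\<bar>a * 2 ^ i - b * 2 ^ i\<bar> \<le> 1"
    using assms by linarith
  then have "\<bar>a - b\<bar> * 2 ^ i \<le> 1"
    by (simp add: abs_mult left_diff_distrib[symmetric])
  then show ?thesis
    by (simp add: field_simps power_one_over)
qed

text \<open>A witness is a triple of a duration \<open>l\<close>, a path \<open>\<gamma>\<close> and
  a branch \<open>\<tau>\<close> certifying that the endpoint lies in the Suslin set. Stabilizing
  labels force \<open>l\<close>, \<open>\<tau>\<close> and the values of \<open>\<gamma>\<close> at
  rational times to converge; the common Lipschitz constant extends this to all times, and
  completeness of \<open>S\<close> provides the limit path. The cost bound is nonstrict so that it
  survives the limit.\<close>

lemma suslin_op_path_sublevel: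
  fixes S :: "'a::metric_space set"
  assumes S: "complete S" and D: "countable D" "\<And>x r. x \<in> S \<Longrightarrow> 0 < r \<Longrightarrow> \<exists>y\<in>D. dist x y < r"
    and F: "\<And>s. closed (F s)" and g: "lsc g" and H: "lsc H"
  shows "\<exists>F'. (\<forall>s. closed (F' s)) \<and>
    {x. \<exists>l \<gamma>. 0 \<le> l \<and> short_path \<gamma> \<and> range \<gamma> \<subseteq> S \<and> \<gamma> 0 = x \<and> \<gamma> l \<in> suslin_op F \<and> H (\<gamma> l) + line_integral l \<gamma> g \<le> c}
    = suslin_op F'"
proof -
  define q where "q = from_nat_into (\<rat> :: real set)"
  have q: "\<exists>j. \<bar>q j - t\<bar> < e" if "0 < e" for t e :: real
  proof -
    have "t - e < t + e"
      using that by simp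
    from Rats_dense_in_real[OF this] obtain r where r: "r \<in> \<rat>" "t - e < r" "r < t + e"
      by blast
    then obtain j where "q j = r"
      using from_nat_into_surj[OF countable_rat] unfolding q_def by blast
    with r show ?thesis
      by (intro exI[of _ j]) (simp add: abs_less_iff)
  qed
  define ix where "ix i y = (LEAST n. dist y (from_nat_into D n) < (1/2) ^ i)" for i and y :: 'a
  have ix: "dist y (from_nat_into D (ix i y)) < (1/2) ^ i" if y: "y \<in> S" for i y
    unfolding ix_def
  proof (rule LeastI_ex)
    obtain z where "z \<in> D" "dist y z < (1/2) ^ i"
      using D(2)[OF y, of "(1/2) ^ i"] by auto
    then show "\<exists>n. dist y (from_nat_into D n) < (1/2) ^ i"
      using from_nat_into_surj[OF D(1)] by metis
  qed
  have ix_eq: "dist y z < 2 * (1/2) ^ i" if "y \<in> S" "z \<in> S" "ix i y = ix i z" for y z i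
    using ix[OF that(1), of i] ix[OF that(2), of i] that(3) dist_triangle2[of y z "from_nat_into D (ix i z)"] by simp
  define R :: "'a \<Rightarrow> real \<times> (real \<Rightarrow> 'a) \<times> (nat \<Rightarrow> nat) \<Rightarrow> bool" where
    "R x = (\<lambda>(l, \<gamma>, \<tau>). 0 \<le> l \<and> short_path \<gamma> \<and> range \<gamma> \<subseteq> S \<and> \<gamma> 0 = x \<and> (\<forall>n. \<gamma> l \<in> F (map \<tau> [0..<n])) \<and>
       H (\<gamma> l) + line_integral l \<gamma> g \<le> c)" for x
  \<comment> \<open>Label \<open>i\<close> records \<open>l\<close> up to \<open>(1/2)^i\<close>,
    the positions at the rational times \<open>q j\<close> with \<open>j < i\<close> up to the same
    order, and the entry \<open>\<tau> i\<close>, coded as one natural number.\<close>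
  define lab :: "nat \<Rightarrow> real \<times> (real \<Rightarrow> 'a) \<times> (nat \<Rightarrow> nat) \<Rightarrow> nat" where
    "lab i = (\<lambda>(l, \<gamma>, \<tau>). to_nat (\<lfloor>l * 2 ^ i\<rfloor>, map (\<lambda>j. ix i (\<gamma> (q j))) [0..<i], \<tau> i))" for i
  have "\<exists>F'. (\<forall>s. closed (F' s)) \<and> {x. \<exists>b. R x b} = suslin_op F'"
  proof (rule suslin_op_projection[where lab = lab])
    fix x X b \<sigma>
    assume X: "X \<longlonglongrightarrow> x" and R: "\<And>k. R (X k) (b k)" and lab: "\<And>i k. i < k \<Longrightarrow> lab i (b k) = \<sigma> i"
    define l \<gamma> \<tau> where "l k = fst (b k)" and "\<gamma> k = fst (snd (b k))" and "\<tau> k = snd (snd (b k))" for k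
    have b: "b k = (l k, \<gamma> k, \<tau> k)" for k
      by (simp add: l_def \<gamma>_def \<tau>_def)
    have R': "0 \<le> l k" "short_path (\<gamma> k)" "range (\<gamma> k) \<subseteq> S" "\<gamma> k 0 = X k" "\<gamma> k (l k) \<in> F (map (\<tau> k) [0..<n])"
      "H (\<gamma> k (l k)) + line_integral (l k) (\<gamma> k) g \<le> c" for k n
      using R[of k] by (auto simp: R_def b)
    have same: "\<lfloor>l k * 2 ^ i\<rfloor> = \<lfloor>l k' * 2 ^ i\<rfloor>" "\<tau> k i = \<tau> k' i" "j < i \<Longrightarrow> ix i (\<gamma> k (q j)) = ix i (\<gamma> k' (q j))"
      if "i < k" "i < k'" for i j k k'
    proof -
      have "to_nat (\<lfloor>l k * 2 ^ i\<rfloor>, map (\<lambda>j. ix i (\<gamma> k (q j))) [0..<i], \<tau> k i) =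
          to_nat (\<lfloor>l k' * 2 ^ i\<rfloor>, map (\<lambda>j. ix i (\<gamma> k' (q j))) [0..<i], \<tau> k' i)"
        using lab[OF that(1)] lab[OF that(2)] by (simp add: lab_def b)
      then show "\<lfloor>l k * 2 ^ i\<rfloor> = \<lfloor>l k' * 2 ^ i\<rfloor>" "\<tau> k i = \<tau> k' i" "j < i \<Longrightarrow> ix i (\<gamma> k (q j)) = ix i (\<gamma> k' (q j))"
        by (auto simp: map_eq_conv)
    qed
    have "Cauchy l"
    proof (rule metric_CauchyI)
      fix e :: real assume "0 < e"
      then obtain i where i: "(1/2) ^ i < e"
        using real_arch_pow_inv[of e "1/2"] by auto
      show "\<exists>N. \<forall>m\<ge>N. \<forall>n\<ge>N. dist (l m) (l n) < e"
      proof (intro exI allI impI)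
        fix m n assume "Suc i \<le> m" "Suc i \<le> n"
        then have "\<bar>l m - l n\<bar> \<le> (1/2) ^ i"
          by (intro abs_diff_le_of_floor_eq same) auto
        with i show "dist (l m) (l n) < e"
          by (simp add: dist_real_def)
      qed
    qed
    then obtain l0 where l0: "l \<longlonglongrightarrow> l0"
      using Cauchy_convergent_iff convergent_def by blast
    have "0 \<le> l0"
      using l0 R'(1) by (intro LIMSEQ_le_const) auto
    have cauchy: "Cauchy (\<lambda>k. \<gamma> k t)" for t
    proof (rule metric_CauchyI)
      fix e :: real assume e: "0 < e"
      then obtain j where j: "\<bar>q j - t\<bar> < e / 4"
        using q[of "e / 4" t] by auto
      obtain i0 where i0: "(1/2) ^ i0 < e / 4"
        using real_arch_pow_inv[of "e / 4" "1/2"] e by auto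
      \<comment> \<open>The time \<open>q j\<close> is recorded only in labels of index above
        \<open>j\<close>, hence \<open>Suc j\<close>. Two quarters of \<open>e\<close> go to the
        labels and one to each Lipschitz estimate.\<close>
      define i where "i = max i0 (Suc j)"
      have "(1/2 :: real) ^ i \<le> (1/2) ^ i0"
        by (intro power_decreasing) (auto simp: i_def)
      then have i: "(1/2 :: real) ^ i < e / 4"
        using i0 by (rule le_less_trans)
      show "\<exists>N. \<forall>m\<ge>N. \<forall>n\<ge>N. dist (\<gamma> m t) (\<gamma> n t) < e"
      proof (intro exI allI impI)
        fix m n assume mn: "Suc i \<le> m" "Suc i \<le> n"
        have "dist (\<gamma> m (q j)) (\<gamma> n (q j)) < 2 * (1/2) ^ i"
        proof (rule ix_eq)
          show "ix i (\<gamma> m (q j)) = ix i (\<gamma> n (q j))"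
            using mn by (intro same(3)) (auto simp: i_def)
        qed (use R'(3) in blast)+
        moreover have "dist (\<gamma> m t) (\<gamma> m (q j)) < e / 4" "dist (\<gamma> n (q j)) (\<gamma> n t) < e / 4"
          using short_pathD[OF R'(2), of m t "q j"] short_pathD[OF R'(2), of n "q j" t] j by (auto simp: abs_minus_commute)
        moreover have "dist (\<gamma> m t) (\<gamma> n t) \<le> dist (\<gamma> m t) (\<gamma> m (q j)) + dist (\<gamma> m (q j)) (\<gamma> n (q j)) + dist (\<gamma> n (q j)) (\<gamma> n t)"
          using dist_triangle[of "\<gamma> m t" "\<gamma> n t" "\<gamma> m (q j)"] dist_triangle[of "\<gamma> m (q j)" "\<gamma> n t" "\<gamma> n (q j)"] by simp
        ultimately show "dist (\<gamma> m t) (\<gamma> n t) < e"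
          using i by simp
      qed
    qed
    have in_S: "\<forall>k. \<gamma> k t \<in> S" for t
      using R'(3) by blast
    have "\<exists>y\<in>S. (\<lambda>k. \<gamma> k t) \<longlonglongrightarrow> y" for t
      by (rule completeE[OF S in_S cauchy]) (rule bexI)
    then obtain \<delta> where \<delta>: "\<And>t. \<delta> t \<in> S" "\<And>t. (\<lambda>k. \<gamma> k t) \<longlonglongrightarrow> \<delta> t"
      by metis
    have "short_path \<delta>"
      unfolding short_path_def
    proof (intro allI)
      fix s t
      have "(\<lambda>k. dist (\<gamma> k s) (\<gamma> k t)) \<longlonglongrightarrow> dist (\<delta> s) (\<delta> t)"
        by (intro tendsto_dist \<delta>)
      then show "dist (\<delta> s) (\<delta> t) \<le> \<bar>s - t\<bar>"
        by (rule LIMSEQ_le_const2) (use short_pathD[OF R'(2)] in blast)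
    qed
    have "\<delta> 0 = x"
      using \<delta>(2)[of 0] X R'(4) LIMSEQ_unique by simp
    have end_lim: "(\<lambda>k. \<gamma> k (l k)) \<longlonglongrightarrow> \<delta> l0"
    proof (rule tendsto_dist_iff[THEN iffD2])
      have "(\<lambda>k. \<bar>l k - l0\<bar> + dist (\<gamma> k l0) (\<delta> l0)) \<longlonglongrightarrow> \<bar>l0 - l0\<bar> + dist (\<delta> l0) (\<delta> l0)"
        by (intro tendsto_intros l0 \<delta>)
      then have bound: "(\<lambda>k. \<bar>l k - l0\<bar> + dist (\<gamma> k l0) (\<delta> l0)) \<longlonglongrightarrow> 0"
        by simp
      have "dist (\<gamma> k (l k)) (\<delta> l0) \<le> \<bar>l k - l0\<bar> + dist (\<gamma> k l0) (\<delta> l0)" for k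
        using dist_triangle[of "\<gamma> k (l k)" "\<delta> l0" "\<gamma> k l0"] short_pathD[OF R'(2), of k "l k" l0] by simp
      then show "(\<lambda>k. dist (\<gamma> k (l k)) (\<delta> l0)) \<longlonglongrightarrow> 0"
        by (intro tendsto_sandwich[OF _ _ tendsto_const bound] always_eventually allI) auto
    qed
    \<comment> \<open>Entry \<open>i\<close> is common to all \<open>\<tau> k\<close> with
      \<open>k > i\<close>; \<open>Suc i\<close> is the least such index.\<close>
    define \<tau>0 where "\<tau>0 i = \<tau> (Suc i) i" for i
    have \<tau>0: "\<tau> k i = \<tau>0 i" if "i < k" for i k
      unfolding \<tau>0_def using that by (intro same(2)) auto
    have "\<delta> l0 \<in> F (map \<tau>0 [0..<n])" for n
    proof (rule Lim_in_closed_set[OF F _ _ end_lim])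
      show "\<forall>\<^sub>F k in sequentially. \<gamma> k (l k) \<in> F (map \<tau>0 [0..<n])"
      proof (rule eventually_sequentiallyI[of n])
        fix k assume "n \<le> k"
        then have "map \<tau>0 [0..<n] = map (\<tau> k) [0..<n]"
          using \<tau>0 by simp
        then show "\<gamma> k (l k) \<in> F (map \<tau>0 [0..<n])"
          using R'(5)[of k n] by (simp only:)
      qed
    qed simp
    moreover have "H (\<delta> l0) + line_integral l0 \<delta> g \<le> c"
      by (rule add_le_of_liminf[OF lsc_le_liminf[OF H end_lim] line_integral_le_liminf[OF g R'(2) \<delta>(2) l0] R'(6)])
    ultimately have "R x (l0, \<delta>, \<tau>0)"
      using \<open>0 \<le> l0\<close> \<open>short_path \<delta>\<close> \<delta>(1) \<open>\<delta> 0 = x\<close> by (auto simp: R_def)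
    then show "\<exists>b. R x b" ..
  qed
  moreover have "{x. \<exists>b. R x b} =
    {x. \<exists>l \<gamma>. 0 \<le> l \<and> short_path \<gamma> \<and> range \<gamma> \<subseteq> S \<and> \<gamma> 0 = x \<and> \<gamma> l \<in> suslin_op F \<and> H (\<gamma> l) + line_integral l \<gamma> g \<le> c}"
    unfolding R_def suslin_op_def by auto
  ultimately show ?thesis
    by simp
qed

text \<open>Since \<open>S\<close> is closed, a path that leaves \<open>S\<close> does so during a
  whole time interval, on which \<open>g = \<infinity>\<close>.\<close>

lemma path_stays_in:
  fixes S :: "'a::metric_space set"
  assumes \<gamma>: "short_path \<gamma>" "\<gamma> 0 \<in> S" and S: "closed S" "\<And>x. x \<notin> S \<Longrightarrow> g x = \<infinity>"
    and fin: "line_integral l \<gamma> g < \<infinity>" and t: "t \<in> {0..l}"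
  shows "\<gamma> t \<in> S"
proof (rule ccontr)
  assume out: "\<gamma> t \<notin> S"
  then have "0 < l"
    using \<gamma>(2) t by (cases "t = 0") auto
  have "open (\<gamma> -` (- S))"
    using S(1) short_path_continuous[OF \<gamma>(1)] by (intro open_vimage open_Compl)
  then obtain e where e: "0 < e" "\<And>s. dist s t < e \<Longrightarrow> \<gamma> s \<notin> S"
    using out unfolding open_dist by auto
  \<comment> \<open>The window about \<open>t\<close> is trimmed to \<open>{0..l}\<close>, the range
    of the line integral; it stays nondegenerate because \<open>0 < l\<close>.\<close>
  define u w where "u = max 0 (t - e / 2)" and "w = min l (t + e / 2)"
  have uw: "u < w" "0 \<le> u" "w \<le> l"
    using t e(1) \<open>0 < l\<close> by (auto simp: u_def w_def)
  have "\<gamma> s \<notin> S" if "s \<in> {u..w}" for s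
    using that e(1) by (intro e(2)) (auto simp: u_def w_def dist_real_def)
  then have "(\<integral>\<^sup>+s. \<infinity> * indicator {u..w} s \<partial>lborel) \<le> line_integral l \<gamma> g"
    unfolding line_integral_def using S(2) uw by (intro nn_integral_mono) (auto simp: indicator_def)
  moreover have "(\<integral>\<^sup>+s. \<infinity> * indicator {u..w} s \<partial>lborel) = (\<infinity> :: ennreal)"
    using uw by (subst nn_integral_cmult) (auto simp: ennreal_top_mult)
  ultimately show False
    using fin by simp
qed

text \<open>The terminal cost need not be lower semicontinuous, so sublevel sets are split by
  endpoint: in \<open>S - U\<close> at cost 0, or anywhere in \<open>S\<close> at cost
  \<open>\<omega>\<close>. The second option admits all of \<open>S\<close> since the trace of
  \<open>U\<close> is merely coanalytic; it creates no value below the infimum, as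
  \<open>\<omega>\<close> is at least the terminal cost.\<close>

lemma path_inf_measurable:
  fixes M :: "'a::metric_space measure" and \<omega> g :: "'a \<Rightarrow> ennreal"
  defines "S \<equiv> measure_support M"
  assumes M: "metric_measure_space M" and null: "emeasure M (- S) = 0" and S: "complete S"
    and U: "analytic_in S (S - U)" and g: "lsc g" "\<And>x. x \<notin> S \<Longrightarrow> g x = \<infinity>" and \<omega>: "lsc \<omega>"
  shows "path_inf g (\<lambda>x. if x \<in> U then \<omega> x else 0) \<in> borel_measurable M"
proof (rule borel_measurableI_less)
  fix a :: ennreal
  let ?F = "\<lambda>x. if x \<in> U then \<omega> x else 0"
  have M': "space M = UNIV" "sets borel \<subseteq> sets M" "complete_measure M"
    using M by (auto simp: metric_measure_space_def)
  interpret complete_measure M by fact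
  have cS: "closed S"
    using S by (rule complete_imp_closed)
  then have "- S \<in> sets M"
    using M'(2) by auto
  then have nullS: "- S \<in> null_sets M"
    using null by auto
  obtain D where D: "countable D" "\<And>x r. x \<in> S \<Longrightarrow> 0 < r \<Longrightarrow> \<exists>y\<in>D. dist x y < r"
    using measure_support_separable[OF M] unfolding S_def by metis
  define E where "E A H c = {x. \<exists>l \<gamma>. 0 \<le> l \<and> short_path \<gamma> \<and> range \<gamma> \<subseteq> S \<and> \<gamma> 0 = x \<and> \<gamma> l \<in> A \<and>
    H (\<gamma> l) + line_integral l \<gamma> g \<le> c}" for A and H :: "'a \<Rightarrow> ennreal" and c
  have E_meas: "E (suslin_op F) H c \<in> sets M" if "\<And>s. closed (F s)" "lsc H" for F H c
  proof -
    from suslin_op_path_sublevel[where F = F and c = c, OF S D that(1) g(1) that(2)]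
    obtain F' where "\<And>s. closed (F' s)" "E (suslin_op F) H c = suslin_op F'"
      unfolding E_def by blast
    then show ?thesis
      using suslin_op_closed_measurable[OF M] by simp
  qed
  from suslin_op_analytic_in[OF U] obtain F where F: "\<And>s. closed (F s)" "S - U = suslin_op F"
    by blast
  have "lsc (\<lambda>x::'a. 0)"
    by (simp add: lsc_def)
  then have E1: "E (S - U) (\<lambda>_. 0) c \<in> sets M" for c
    using E_meas[OF F(1)] F(2) by simp
  have E2: "E S \<omega> c \<in> sets M" for c
    using E_meas[of "\<lambda>_. S" \<omega> c] cS \<omega> by (simp add: suslin_op_const)
  \<comment> \<open>Rational thresholds turn the strict bound \<open>a\<close> into countably many
    nonstrict ones, which are closed conditions. Negative rationals merely give the threshold
    0.\<close>
  define I where "I = {r::rat. ennreal (of_rat r) < a}"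
  have "(\<Union>r\<in>I. E (S - U) (\<lambda>_. 0) (ennreal (of_rat r)) \<union> E S \<omega> (ennreal (of_rat r))) \<in> sets M"
    using E1 E2 by (intro sets.countable_UN' sets.Un) auto
  moreover have "(\<Union>r\<in>I. E (S - U) (\<lambda>_. 0) (ennreal (of_rat r)) \<union> E S \<omega> (ennreal (of_rat r))) = {x\<in>S. path_inf g ?F x < a}"
  proof (intro equalityI subsetI)
    fix x assume "x \<in> (\<Union>r\<in>I. E (S - U) (\<lambda>_. 0) (ennreal (of_rat r)) \<union> E S \<omega> (ennreal (of_rat r)))"
    then obtain r where r: "ennreal (of_rat r) < a" "x \<in> E (S - U) (\<lambda>_. 0) (ennreal (of_rat r)) \<union> E S \<omega> (ennreal (of_rat r))"
      by (auto simp: I_def)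
    have "\<exists>l \<gamma>. 0 \<le> l \<and> short_path \<gamma> \<and> range \<gamma> \<subseteq> S \<and> \<gamma> 0 = x \<and> ?F (\<gamma> l) + line_integral l \<gamma> g \<le> ennreal (of_rat r)"
    proof (cases "x \<in> E (S - U) (\<lambda>_. 0) (ennreal (of_rat r))")
      case True
      then show ?thesis
        unfolding E_def by auto
    next
      case False
      with r(2) obtain l \<gamma> where *: "0 \<le> l" "short_path \<gamma>" "range \<gamma> \<subseteq> S" "\<gamma> 0 = x" "\<omega> (\<gamma> l) + line_integral l \<gamma> g \<le> ennreal (of_rat r)"
        unfolding E_def by auto
      have "?F (\<gamma> l) + line_integral l \<gamma> g \<le> \<omega> (\<gamma> l) + line_integral l \<gamma> g"
        by (intro add_right_mono) simp
      with * show ?thesis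
        by (blast intro: order_trans)
    qed
    then obtain l \<gamma> where *: "0 \<le> l" "short_path \<gamma>" "range \<gamma> \<subseteq> S" "\<gamma> 0 = x" "?F (\<gamma> l) + line_integral l \<gamma> g \<le> ennreal (of_rat r)"
      by blast
    have "path_inf g ?F x < a"
      unfolding path_inf_less_iff using * r(1) le_less_trans by blast
    moreover have "x \<in> S"
      using * by auto
    ultimately show "x \<in> {x\<in>S. path_inf g ?F x < a}"
      by simp
  next
    fix x assume "x \<in> {x\<in>S. path_inf g ?F x < a}"
    then obtain l \<gamma> where x: "x \<in> S" and *: "0 \<le> l" "short_path \<gamma>" "\<gamma> 0 = x" "?F (\<gamma> l) + line_integral l \<gamma> g < a"
      unfolding path_inf_less_iff by blast
    then obtain r :: rat where r: "?F (\<gamma> l) + line_integral l \<gamma> g < ennreal (of_rat r)" "ennreal (of_rat r) < a"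
      using ennreal_rat_dense by blast
    have fin: "line_integral l \<gamma> g < \<infinity>"
      using *(4) by (auto simp: less_top[symmetric])
    \<comment> \<open>Finite cost confines the path to \<open>S\<close> only during
      \<open>{0..l}\<close>, whereas \<open>E\<close> asks it of the whole line; freezing beyond the
      endpoints repairs this.\<close>
    define \<delta> where "\<delta> t = \<gamma> (max 0 (min l t))" for t
    have in_S: "\<gamma> t \<in> S" if "t \<in> {0..l}" for t
      using path_stays_in[OF *(2) _ cS g(2) fin that] *(3) x by simp
    have \<delta>: "short_path \<delta>" "range \<delta> \<subseteq> S" "\<delta> 0 = x" "\<delta> l = \<gamma> l" "line_integral l \<delta> g = line_integral l \<gamma> g"
    proof -
      show "short_path \<delta>"
        unfolding \<delta>_def[abs_def] using *(1) short_path_dist_le[OF *(2)] by (intro short_path_clamp)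
      show "range \<delta> \<subseteq> S"
        using in_S *(1) by (auto simp: \<delta>_def)
      show "\<delta> 0 = x" "\<delta> l = \<gamma> l"
        using * by (auto simp: \<delta>_def)
      show "line_integral l \<delta> g = line_integral l \<gamma> g"
        by (rule line_integral_cong) (auto simp: \<delta>_def)
    qed
    have "\<gamma> l \<in> S"
      using *(1) by (intro in_S) simp
    have "x \<in> E (S - U) (\<lambda>_. 0) (ennreal (of_rat r)) \<union> E S \<omega> (ennreal (of_rat r))"
    proof (cases "\<gamma> l \<in> U")
      case True
      then have "x \<in> E S \<omega> (ennreal (of_rat r))"
        unfolding E_def using \<delta> *(1) r(1) \<open>\<gamma> l \<in> S\<close> by (auto intro!: exI[of _ l] exI[of _ \<delta>])
      then show ?thesis ..
    next
      case False
      then have "x \<in> E (S - U) (\<lambda>_. 0) (ennreal (of_rat r))"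
        unfolding E_def using \<delta> *(1) r(1) \<open>\<gamma> l \<in> S\<close> by (auto intro!: exI[of _ l] exI[of _ \<delta>])
      then show ?thesis ..
    qed
    then show "x \<in> (\<Union>r\<in>I. E (S - U) (\<lambda>_. 0) (ennreal (of_rat r)) \<union> E S \<omega> (ennreal (of_rat r)))"
      using r(2) unfolding I_def by blast
  qed
  ultimately have "{x\<in>S. path_inf g ?F x < a} \<in> sets M"
    by simp
  \<comment> \<open>The Suslin description covers only \<open>S\<close>; the rest is a subset of a
    null set, hence measurable by completeness.\<close>
  moreover have "{x\<in>- S. path_inf g ?F x < a} \<in> sets M"
    by (rule complete[OF _ nullS]) auto
  ultimately have "{x\<in>S. path_inf g ?F x < a} \<union> {x\<in>- S. path_inf g ?F x < a} \<in> sets M"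
    by (rule sets.Un)
  moreover have "{x\<in>S. path_inf g ?F x < a} \<union> {x\<in>- S. path_inf g ?F x < a} = {x\<in>space M. path_inf g ?F x < a}"
    using M'(1) by auto
  ultimately show "{x\<in>space M. path_inf g ?F x < a} \<in> sets M"
    by simp
qed

subsection \<open>Quasiopenness\<close>

lemma ennreal_powr_mono: "x \<le> y \<Longrightarrow> 0 < p \<Longrightarrow> ennreal_powr x p \<le> ennreal_powr y p"
  unfolding ennreal_powr_def
  by (auto simp: top_unique less_top[symmetric] intro!: ennreal_leI powr_mono2 enn2real_mono)

lemma ennreal_powr_powr:
  assumes "0 < a" "a * b = 1"
  shows "ennreal_powr (ennreal_powr x a) b = x"
proof (cases "x = \<infinity>")
  case False
  then have "ennreal (enn2real x) = x"
    by (simp add: less_top)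
  then show ?thesis
    using False assms by (simp add: ennreal_powr_def powr_powr)
qed (simp add: ennreal_powr_def)

lemma ennreal_powr_less_top_iff: "ennreal_powr x p < \<infinity> \<longleftrightarrow> x < \<infinity>"
  by (auto simp: ennreal_powr_def less_top[symmetric])

lemma less_ennreal_powr_iff:
  assumes "0 < p"
  shows "a < ennreal_powr y (1 / p) \<longleftrightarrow> ennreal_powr a p < y"
proof -
  have "ennreal_powr y (1 / p) \<le> a \<longleftrightarrow> y \<le> ennreal_powr a p"
    using ennreal_powr_mono[of "ennreal_powr y (1 / p)" a p] ennreal_powr_mono[of y "ennreal_powr a p" "1 / p"]
      ennreal_powr_powr[of "1 / p" p y] ennreal_powr_powr[of p "1 / p" a] assms by auto
  then show ?thesis
    by (simp add: not_le[symmetric])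
qed

lemma ennreal_powr_le_self:
  assumes "x \<le> 1" "1 \<le> p"
  shows "ennreal_powr x p \<le> x"
proof -
  from assms(1) have "x \<noteq> \<infinity>"
    by (auto simp: top_unique)
  then have x: "x = ennreal (enn2real x)"
    by (simp add: less_top)
  then have "enn2real x \<le> 1"
    using assms(1) by (metis enn2real_nonneg ennreal_le_1)
  then have "enn2real x powr p \<le> enn2real x powr 1"
    using assms(2) by (intro powr_mono') auto
  then have "ennreal (enn2real x powr p) \<le> ennreal (enn2real x)"
    by (intro ennreal_leI) simp
  then show ?thesis
    using x \<open>x \<noteq> \<infinity>\<close> by (simp add: ennreal_powr_def)
qed

lemma ennreal_powr_measurable [measurable]:
  "(\<lambda>x. ennreal_powr x p) \<in> borel_measurable borel"
  unfolding ennreal_powr_def by measurable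

theorem theorem5p7:
  fixes M :: "'a::metric_space measure" and p :: real and U :: "'a set"
  assumes "1 \<le> p"
    and "metric_measure_space M"
    and "emeasure M (- measure_support M) = 0"
    and "complete (measure_support M)"
    and "\<And>u. \<lbrakk>u \<in> newtonian_space p M; \<exists>C::real. \<forall>x. \<bar>u x\<bar> \<le> ereal C\<rbrakk> \<Longrightarrow> quasicontinuous p M u"
    and "p_path_open p M U"
    and "analytic_in (measure_support M) (measure_support M - U)"
  shows "quasiopen p M U"
proof -
  define S where "S = measure_support M"
  have p: "0 < p"
    using assms(1) by simp
  have M: "space M = UNIV" "sets borel \<subseteq> sets M"
    using assms(2) by (auto simp: metric_measure_space_def)
  have "closed S"
    unfolding S_def using assms(4) by (rule complete_imp_closed)
  then have "- S \<in> null_sets M"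
    using assms(3) M(2) by (intro null_setsI) (auto simp: S_def)
  then have AE_S: "AE x in M. x \<in> S"
    using AE_not_in by force
  obtain \<omega> :: "'a \<Rightarrow> ennreal" where \<omega>: "\<omega> \<in> borel_measurable borel" "\<And>x. 0 < \<omega> x" "\<And>x. \<omega> x \<le> 1"
    "\<And>x. \<forall>\<^sub>F y in nhds x. \<omega> x \<le> \<omega> y" "\<And>x. \<exists>c>0. \<forall>y\<in>ball x 1. ennreal c \<le> \<omega> y" "(\<integral>\<^sup>+x. \<omega> x \<partial>M) < \<infinity>"
    by (rule ex_integrable_weight[OF assms(2)]) (rule that; assumption)
  have \<omega>_fin: "\<omega> x < \<infinity>" for x
    using \<omega>(3)[of x] by (auto intro: le_less_trans)
  from assms(6) obtain \<rho> where \<rho>: "\<rho> \<in> borel_measurable borel" "(\<integral>\<^sup>+x. ennreal_powr (\<rho> x) p \<partial>M) < \<infinity>"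
    and exceptional: "\<And>l \<gamma>. arc_length_curve l \<gamma> \<Longrightarrow> \<not> openin (top_of_set {0..l}) {t \<in> {0..l}. \<gamma> t \<in> U} \<Longrightarrow>
      line_integral l \<gamma> \<rho> = \<infinity>"
    unfolding p_path_open_def p_ae_curve_def exceptional_family_def by auto
  have "(\<lambda>x. ennreal_powr (\<rho> x) p) \<in> borel_measurable borel"
    using \<rho>(1) by measurable
  \<comment> \<open>The majorant is taken for the \<open>p\<close>-th power of \<open>\<rho>\<close>
    and the root is extracted afterwards, because \<open>lsc_majorant\<close> deals with plain
    integrals.\<close>
  from lsc_majorant[OF M(2,1) \<omega>(1,4,2) \<omega>_fin \<omega>(6) this \<rho>(2)] obtain G where
    G: "lsc G" "\<And>x. ennreal_powr (\<rho> x) p \<le> G x" "\<And>x. \<omega> x \<le> G x" "(\<integral>\<^sup>+x. G x \<partial>M) < \<infinity>"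
    by blast
  \<comment> \<open>The value \<open>\<infinity>\<close> off \<open>S\<close> adds nothing to the
    integral, as \<open>- S\<close> is null, and keeps \<open>g\<close> lower semicontinuous, as
    \<open>- S\<close> is open.\<close>
  define g where "g x = (if x \<in> S then ennreal_powr (G x) (1 / p) else \<infinity>)" for x
  have "lsc g"
    unfolding lsc_def
  proof
    fix a :: ennreal
    show "open {x. a < g x}"
    proof (cases "a = \<infinity>")
      case False
      then have "{x. a < g x} = - S \<union> {x. ennreal_powr a p < G x}"
        using p by (auto simp: g_def less_ennreal_powr_iff less_top)
      then show ?thesis
        using \<open>closed S\<close> G(1) by (simp add: lsc_def open_Un open_Compl)
    qed simp
  qed
  then have g_borel: "g \<in> borel_measurable borel"
    by (rule lsc_borel)
  have \<rho>_le: "\<rho> x \<le> g x" for x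
    using ennreal_powr_mono[OF G(2)[of x], of "1 / p"] p ennreal_powr_powr[of p "1 / p" "\<rho> x"] by (simp add: g_def)
  have \<omega>_le: "\<omega> x \<le> g x" for x
  proof -
    \<comment> \<open>As \<open>\<omega> \<le> 1\<close> and \<open>p \<ge> 1\<close>, the power
      does not increase \<open>\<omega>\<close>, so the bound by \<open>G\<close> survives the
      root.\<close>
    have "ennreal_powr (\<omega> x) p \<le> G x"
      using ennreal_powr_le_self[OF \<omega>(3) assms(1)] G(3) by (rule order_trans)
    from ennreal_powr_mono[OF this, of "1 / p"] show ?thesis
      using p ennreal_powr_powr[of p "1 / p" "\<omega> x"] by (simp add: g_def)
  qed
  have "(\<integral>\<^sup>+x. ennreal_powr (g x) p \<partial>M) = (\<integral>\<^sup>+x. G x \<partial>M)"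
    using AE_S
  proof (intro nn_integral_cong_AE, eventually_elim)
    case (elim x)
    then show ?case
      using p ennreal_powr_powr[of "1 / p" p "G x"] by (simp add: g_def)
  qed
  with G(4) have g_int: "(\<integral>\<^sup>+x. ennreal_powr (g x) p \<partial>M) < \<infinity>"
    by simp
  have "lsc \<omega>"
    unfolding lsc_def
  proof (intro allI, subst open_subopen, intro ballI)
    fix a x assume "x \<in> {x. a < \<omega> x}"
    then have "\<forall>\<^sub>F y in nhds x. a < \<omega> y"
      using \<omega>(4)[of x] by (auto elim!: eventually_mono intro: less_le_trans)
    then show "\<exists>T. open T \<and> x \<in> T \<and> T \<subseteq> {x. a < \<omega> x}"
      unfolding eventually_nhds by blast
  qed
  define F where "F x = (if x \<in> U then \<omega> x else 0)" for x
  have F_le: "F x \<le> \<omega> x" "F x < \<infinity>" for x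
    using \<omega>_fin by (auto simp: F_def)
  define v where "v = path_inf g F"
  have v_le: "v x \<le> F x" for x
    unfolding v_def by (rule path_inf_le_start)
  have v_\<omega>: "v x \<le> \<omega> x" for x
    using v_le F_le(1) by (rule order_trans)
  have v_1: "v x \<le> 1" for x
    using v_\<omega> \<omega>(3) by (rule order_trans)
  have v_meas[measurable]: "v \<in> borel_measurable M"
    unfolding v_def F_def[abs_def]
    by (rule path_inf_measurable[OF assms(2,3,4,7) \<open>lsc g\<close> _ \<open>lsc \<omega>\<close>]) (simp add: g_def S_def)
  define u where "u x = enn2ereal (v x)" for x
  have abs_u: "\<bar>u x\<bar> = enn2ereal (v x)" for x
    by (simp add: u_def)
  have "u \<in> newtonian_space p M"
  proof -
    have "u \<in> borel_measurable M"
      unfolding u_def by measurable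
    have "upper_gradient g u"
      unfolding u_def[abs_def] v_def by (rule upper_gradient_path_inf[OF g_borel F_le(2)])
    then have "(INF g \<in> {g. upper_gradient g u}. \<integral>\<^sup>+ x. ennreal_powr (g x) p \<partial>M) \<le> (\<integral>\<^sup>+ x. ennreal_powr (g x) p \<partial>M)"
      by (intro INF_lower) simp
    then have "(INF g \<in> {g. upper_gradient g u}. \<integral>\<^sup>+ x. ennreal_powr (g x) p \<partial>M) < \<infinity>"
      using g_int by (rule le_less_trans)
    moreover have "(\<integral>\<^sup>+ x. ennreal_powr (e2ennreal \<bar>u x\<bar>) p \<partial>M) \<le> (\<integral>\<^sup>+ x. \<omega> x \<partial>M)"
    proof (rule nn_integral_mono)
      fix x
      have "ennreal_powr (v x) p \<le> v x"
        using v_1 assms(1) by (rule ennreal_powr_le_self)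
      also have "\<dots> \<le> \<omega> x"
        by (rule v_\<omega>)
      finally show "ennreal_powr (e2ennreal \<bar>u x\<bar>) p \<le> \<omega> x"
        by (simp add: abs_u)
    qed
    then have "(\<integral>\<^sup>+ x. ennreal_powr (e2ennreal \<bar>u x\<bar>) p \<partial>M) < \<infinity>"
      using \<omega>(6) by (rule le_less_trans)
    ultimately have "newtonian_norm p M u < \<infinity>"
      unfolding newtonian_norm_def ennreal_powr_less_top_iff by (simp add: ennreal_add_less_top)
    with \<open>u \<in> borel_measurable M\<close> show ?thesis
      by (simp add: newtonian_space_def)
  qed
  moreover have "\<forall>x. \<bar>u x\<bar> \<le> ereal 1"
    unfolding abs_u using v_1 by (simp add: less_eq_ennreal.rep_eq one_ennreal.rep_eq one_ereal_def)
  ultimately have qc: "quasicontinuous p M u"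
    using assms(5) by blast
  have u_pos: "0 < u x \<longleftrightarrow> x \<in> U" for x
  proof
    assume "x \<in> U"
    obtain c where c: "0 < c" "\<forall>y\<in>ball x 1. ennreal c \<le> \<omega> y"
      using \<omega>(5) by blast
    have "0 < v x"
      unfolding v_def
    proof (rule path_inf_pos[OF g_borel \<rho>(1) \<rho>_le c(1)])
      show "ennreal c \<le> g y" if "y \<in> ball x 1" for y
        using bspec[OF c(2) that] \<omega>_le by (rule order_trans)
      show "ennreal c \<le> F y" if "y \<in> ball x 1 \<inter> U" for y
        using c(2) that by (simp add: F_def)
      show "openin (top_of_set {0..l}) {t \<in> {0..l}. \<gamma> t \<in> U}"
        if "arc_length_curve l \<gamma>" "line_integral l \<gamma> \<rho> < \<infinity>" for l \<gamma>
        using exceptional[OF that(1)] that(2) by (metis less_irrefl)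
    qed fact
    then show "0 < u x"
      by (simp add: u_def less_ennreal.rep_eq zero_ennreal.rep_eq)
  next
    assume "0 < u x"
    then have "0 < v x"
      by (simp add: u_def less_ennreal.rep_eq zero_ennreal.rep_eq)
    then have "0 < F x"
      using v_le by (rule less_le_trans)
    then show "x \<in> U"
      by (auto simp: F_def split: if_splits)
  qed
  show ?thesis
    unfolding quasiopen_def
  proof (intro allI impI)
    fix \<epsilon> :: real assume "0 < \<epsilon>"
    with qc obtain V where V: "open V" "sobolev_capacity p M V < ennreal \<epsilon>" "continuous_on (- V) u"
      unfolding quasicontinuous_def by blast
    \<comment> \<open>On \<open>- V\<close> continuity of \<open>u\<close> makes the set where
      \<open>u\<close> is positive the trace of an open set \<open>T\<close>, so \<open>U\<close>
      and \<open>T\<close> differ only inside \<open>V\<close>.\<close>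
    obtain T where T: "open T" "T \<inter> - V = u -` {0<..} \<inter> - V"
      using V(3) unfolding continuous_on_open_invariant by (metis open_greaterThan)
    have "V \<union> U = V \<union> T"
      using T(2) u_pos by auto
    then show "\<exists>G. open G \<and> sobolev_capacity p M G < ennreal \<epsilon> \<and> open (G \<union> U)"
      using V T(1) by (intro exI[of _ V]) auto
  qed
qed

end
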